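(* Let $n\geq2$ and $r=n-2$. The Hilbert--Poincaré series of $Z_n(\mathfrak{sl}_2)$ is $$F_n(t)=\frac{P_r(t)}{(1-t^2)^{3(r+1)}},$$ where $$P_r(t)=(1+t)^r\sum_{k=0}^{2r}(-1)^ka_kt^k,\qquad a_{2k}=\binom{r}{k}^2,\qquad a_{2k+1}=\binom{r}{k}\binom{r}{k+1}.$$
   Context: Everything is over $\mathbb{C}$. $\mathfrak{sl}_2$ is spanned by $e_{ij}$, $i,j\in\{1,2\}$, with $[e_{ij},e_{k\ell}]=\delta_{jk}e_{i\ell}-\delta_{\ell i}e_{kj}$ and $e_{11}+e_{22}=0$. In $U(\mathfrak{sl}_2)^{\otimes n}$ write $e_{ij}^{(a)}=1^{\otimes(a-1)}\otimes e_{ij}\otimes 1^{\otimes(n-a)}$. The diagonal embedding is the algebra map $\delta:U(\mathfrak{sl}_2)\to U(\mathfrak{sl}_2)^{\otimes n}$, $e_{ij}\mapsto\sum_{a=1}^n e_{ij}^{(a)}$, and the centralizer is $Z_n(\mathfrak{sl}_2)=\{X\in U(\mathfrak{sl}_2)^{\otimes n} : [\delta(g),X]=0\ \forall g\in U(\mathfrak{sl}_2)\}$. $U(\mathfrak{sl}_2)^{\otimes n}$ is filtered by giving each generator $e_{ij}^{(a)}$ degree $1$; $Z_n(\mathfrak{sl}_2)_{\leq k}$ (resp. $Z_n(\mathfrak{sl}_2)_{<k}$) denotes the subspace of elements of $Z_n(\mathfrak{sl}_2)$ of degree at most $k$ (resp. less than $k$). The Hilbert--Poincaré series is the formal power series $$F_n(t)=\sum_{k\geq0}\dim\bigl(Z_n(\mathfrak{sl}_2)_{\leq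 k}/Z_n(\mathfrak{sl}_2)_{<k}\bigr)t^k .$$ *)

theory Defs
  imports
    "HOL-Library.Poly_Mapping"
    "HOL-Library.Numeral_Type"
    "HOL-Computational_Algebra.Polynomial_FPS"
    "Jordan_Normal_Form.VS_Connect"
begin

section \<open>Complex algebras\<close>

class complex_algebra_1 = ring_1 +
  fixes cscale :: "complex \<Rightarrow> 'a \<Rightarrow> 'a"  (infixr \<open>*\<^sub>C\<close> 75)
  assumes cscale_add_right: "c *\<^sub>C (x + y) = c *\<^sub>C x + c *\<^sub>C y"
    and cscale_add_left: "(c + d) *\<^sub>C x = c *\<^sub>C x + d *\<^sub>C x"
    and cscale_cscale: "c *\<^sub>C d *\<^sub>C x = (c * d) *\<^sub>C x"
    and cscale_one: "1 *\<^sub>C x = x"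
    and mult_cscale_left: "(c *\<^sub>C x) * y = c *\<^sub>C (x * y)"
    and mult_cscale_right: "x * (c *\<^sub>C y) = c *\<^sub>C (x * y)"

global_interpretation calg: vector_space "cscale :: complex \<Rightarrow> 'a :: complex_algebra_1 \<Rightarrow> 'a"
  by unfold_locales
    (auto simp: cscale_add_right cscale_add_left cscale_cscale cscale_one)

instantiation complex :: complex_algebra_1
begin
definition cscale_complex :: "complex \<Rightarrow> complex \<Rightarrow> complex" where
  "cscale_complex c x = c * x"
instance by standard (auto simp: cscale_complex_def algebra_simps)
end

text \<open>The monoid algebra: \<^typ>\<open>'m \<Rightarrow>\<^sub>0 'a\<close> with the convolution product.\<close>

instantiation poly_mapping :: (monoid_add, complex_algebra_1) complex_algebra_1
begin

definition cscale_poly_mapping :: "complex \<Rightarrow> ('a \<Rightarrow>\<^sub>0 'b) \<Rightarrow> ('a \<Rightarrow>\<^sub>0 'b)" where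
  "cscale_poly_mapping c p = Poly_Mapping.map ((*\<^sub>C) c) p"

lemma lookup_cscale [simp]: "Poly_Mapping.lookup (c *\<^sub>C p) k = c *\<^sub>C Poly_Mapping.lookup p k" for p :: "'a \<Rightarrow>\<^sub>0 'b"
  by (simp add: cscale_poly_mapping_def Poly_Mapping.map.rep_eq when_def)

lemma cscale_conv_mult_left: "c *\<^sub>C p = Poly_Mapping.single 0 (c *\<^sub>C 1) * p" for p :: "'a \<Rightarrow>\<^sub>0 'b"
proof -
  have "(*\<^sub>C) c = (*) (c *\<^sub>C (1 :: 'b))"
    by (auto simp: fun_eq_iff mult_cscale_left)
  hence "Poly_Mapping.map ((*\<^sub>C) c) p = Poly_Mapping.map ((*) (c *\<^sub>C 1)) p"
    by (rule arg_cong)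
  also have "\<dots> = Poly_Mapping.single 0 (c *\<^sub>C 1) * p"
    by (rule mult_map_scale_conv_mult)
  finally show ?thesis
    unfolding cscale_poly_mapping_def .
qed

lemma single_central: "p * Poly_Mapping.single 0 (c *\<^sub>C 1) = Poly_Mapping.single 0 (c *\<^sub>C 1) * p"
  for p :: "'a \<Rightarrow>\<^sub>0 'b"
proof (induction p rule: update_induct)
  case const
  show ?case by simp
next
  case (update f a b)
  have "Poly_Mapping.update a b f = f + Poly_Mapping.single a b"
    using update.hyps
    by (intro poly_mapping_eqI) (auto simp: lookup_update lookup_add lookup_single when_def in_keys_iff)
  thus ?case using update.IH
    by (simp add: algebra_simps mult_single mult_cscale_left mult_cscale_right)
qed

instance
proof
  fix c d :: complex and x y :: "'a \<Rightarrow>\<^sub>0 'b"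
  show "c *\<^sub>C (x + y) = c *\<^sub>C x + c *\<^sub>C y"
    by (intro poly_mapping_eqI) (simp add: lookup_add cscale_add_right)
  show "(c + d) *\<^sub>C x = c *\<^sub>C x + d *\<^sub>C x"
    by (intro poly_mapping_eqI) (simp add: lookup_add cscale_add_left)
  show "c *\<^sub>C d *\<^sub>C x = (c * d) *\<^sub>C x"
    by (intro poly_mapping_eqI) (simp add: cscale_cscale)
  show "1 *\<^sub>C x = x"
    by (intro poly_mapping_eqI) (simp add: cscale_one)
  show "(c *\<^sub>C x) * y = c *\<^sub>C (x * y)"
    by (simp add: cscale_conv_mult_left mult.assoc)
  show "x * (c *\<^sub>C y) = c *\<^sub>C (x * y)"
    unfolding cscale_conv_mult_left mult.assoc[symmetric] single_central ..
qed

end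

text \<open>Linear extension of a function on the basis of a monoid algebra.\<close>

definition lin_ext :: "('m \<Rightarrow> 'a) \<Rightarrow> ('m \<Rightarrow>\<^sub>0 complex) \<Rightarrow> 'a :: complex_algebra_1" where
  "lin_ext h p = (\<Sum>m\<in>Poly_Mapping.keys p. Poly_Mapping.lookup p m *\<^sub>C h m)"

lemma lin_ext_superset:
  assumes "finite A" "Poly_Mapping.keys p \<subseteq> A"
  shows "lin_ext h p = (\<Sum>m\<in>A. Poly_Mapping.lookup p m *\<^sub>C h m)"
  unfolding lin_ext_def using assms
  by (intro sum.mono_neutral_left) (auto simp: in_keys_iff)

lemma lin_ext_add: "lin_ext h (p + q) = lin_ext h p + lin_ext h q"
proof -
  let ?A = "Poly_Mapping.keys p \<union> Poly_Mapping.keys q"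
  have "lin_ext h (p + q) = (\<Sum>m\<in>?A. Poly_Mapping.lookup (p + q) m *\<^sub>C h m)"
    by (rule lin_ext_superset) (auto dest: subsetD[OF Poly_Mapping.keys_add])
  also have "\<dots> = (\<Sum>m\<in>?A. Poly_Mapping.lookup p m *\<^sub>C h m) + (\<Sum>m\<in>?A. Poly_Mapping.lookup q m *\<^sub>C h m)"
    by (simp add: lookup_add cscale_add_left sum.distrib)
  also have "\<dots> = lin_ext h p + lin_ext h q"
    by (subst (1 2) lin_ext_superset[where A = ?A]) auto
  finally show ?thesis .
qed

lemma lin_ext_0 [simp]: "lin_ext h 0 = 0"
  by (simp add: lin_ext_def)

lemma lin_ext_single [simp]: "lin_ext h (Poly_Mapping.single m c) = c *\<^sub>C h m"
  by (auto simp: lin_ext_def)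

lemma lin_ext_cscale: "lin_ext h (c *\<^sub>C p) = c *\<^sub>C lin_ext h p"
proof -
  have "lin_ext h (c *\<^sub>C p) = (\<Sum>m\<in>Poly_Mapping.keys p. Poly_Mapping.lookup (c *\<^sub>C p) m *\<^sub>C h m)"
    by (rule lin_ext_superset) (auto simp: in_keys_iff)
  also have "\<dots> = c *\<^sub>C lin_ext h p"
    by (simp add: lin_ext_def calg.scale_sum_right cscale_cscale cscale_complex_def)
  finally show ?thesis .
qed

lemma lin_ext_diff: "lin_ext h (p - q) = lin_ext h p - lin_ext h q"
  using lin_ext_add[of h "p - q" q] by simp

lemma poly_mapping_linear_induct [case_names zero single add]:
  fixes p :: "'m \<Rightarrow>\<^sub>0 'b :: comm_monoid_add"
  assumes "P 0" "\<And>m c. P (Poly_Mapping.single m c)" "\<And>p q. P p \<Longrightarrow> P q \<Longrightarrow> P (p + q)"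
  shows "P p"
proof (induction p rule: update_induct)
  case const
  show ?case by (rule assms)
next
  case (update f a b)
  have "Poly_Mapping.update a b f = f + Poly_Mapping.single a b"
    using update.hyps
    by (intro poly_mapping_eqI) (auto simp: lookup_update lookup_add lookup_single when_def in_keys_iff)
  thus ?case using update.IH assms by auto
qed

lemma lin_ext_mult:
  fixes p q :: "'m :: monoid_add \<Rightarrow>\<^sub>0 complex"
  assumes "\<And>u v. h (u + v) = h u * h v"
  shows "lin_ext h (p * q) = lin_ext h p * lin_ext h q"
proof (induction p rule: poly_mapping_linear_induct)
  case (single m c)
  show ?case
  proof (induction q rule: poly_mapping_linear_induct)
    case (single m' c')
    show ?case
      by (simp add: mult_single assms mult_cscale_left mult_cscale_right cscale_cscale mult_ac)
  qed (simp_all add: lin_ext_add algebra_simps)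
qed (simp_all add: lin_ext_add algebra_simps)

text \<open>Congruence modulo a subspace, as needed for the quotient constructions below.\<close>

lemma
  fixes S :: "'a :: complex_algebra_1 set"
  shows span_cong_equivp: "equivp (\<lambda>x y. x - y \<in> calg.span S)"
    and span_cong_eqI: "a = b \<Longrightarrow> a - b \<in> calg.span S"
    and span_cong_add: "a - b \<in> calg.span S \<Longrightarrow> c - d \<in> calg.span S \<Longrightarrow> (a + c) - (b + d) \<in> calg.span S"
    and span_cong_diff: "a - b \<in> calg.span S \<Longrightarrow> c - d \<in> calg.span S \<Longrightarrow> (a - c) - (b - d) \<in> calg.span S"
    and span_cong_minus: "a - b \<in> calg.span S \<Longrightarrow> - a - (- b) \<in> calg.span S"
    and span_cong_cscale: "a - b \<in> calg.span S \<Longrightarrow> z *\<^sub>C a - z *\<^sub>C b \<in> calg.span S"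
proof -
  show "a = b \<Longrightarrow> a - b \<in> calg.span S"
    by (simp add: calg.span_zero)
  show "a - b \<in> calg.span S \<Longrightarrow> c - d \<in> calg.span S \<Longrightarrow> (a + c) - (b + d) \<in> calg.span S"
    using calg.span_add[of "a - b" S "c - d"] by (simp add: algebra_simps)
  show "a - b \<in> calg.span S \<Longrightarrow> c - d \<in> calg.span S \<Longrightarrow> (a - c) - (b - d) \<in> calg.span S"
    using calg.span_diff[of "a - b" S "c - d"] by (simp add: algebra_simps)
  show minus: "a - b \<in> calg.span S \<Longrightarrow> - a - (- b) \<in> calg.span S" for a b
    using calg.span_neg[of "a - b" S] by simp
  show "a - b \<in> calg.span S \<Longrightarrow> z *\<^sub>C a - z *\<^sub>C b \<in> calg.span S"
    using calg.span_scale[of "a - b" S z] by (simp add: calg.scale_right_diff_distrib)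
  show "equivp (\<lambda>x y. x - y \<in> calg.span S)"
  proof (rule equivpI)
    show "reflp (\<lambda>x y. x - y \<in> calg.span S)"
      by (rule reflpI) (simp add: calg.span_zero)
    show "symp (\<lambda>x y. x - y \<in> calg.span S)"
      using minus by (intro sympI) fastforce
    show "transp (\<lambda>x y. x - y \<in> calg.span S)"
    proof (rule transpI)
      fix x y z assume "x - y \<in> calg.span S" "y - z \<in> calg.span S"
      thus "x - z \<in> calg.span S"
        using calg.span_add[of "x - y" S "y - z"] by simp
    qed
  qed
qed

definition two_sided_ideal :: "'a :: complex_algebra_1 set \<Rightarrow> 'a set" where
  "two_sided_ideal S = calg.span {a * s * b | a s b. s \<in> S}"

lemma span_mult_closed:
  fixes S :: "'a :: complex_algebra_1 set"
  assumes "\<And>s. s \<in> S \<Longrightarrow> f s \<in> calg.span S" "x \<in> calg.span S"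
    and "\<And>x y. f (x + y) = f x + f y" "\<And>c x. f (c *\<^sub>C x) = c *\<^sub>C f x"
  shows "f x \<in> calg.span S"
  using assms(2)
proof (induction rule: calg.span_induct_alt)
  case base
  have "f 0 = 0" using assms(3)[of 0 0] by simp
  thus ?case by (simp add: calg.span_zero)
next
  case (step c x y)
  thus ?case
    by (auto simp: assms(3,4) intro!: calg.span_add calg.span_scale assms(1))
qed

lemma two_sided_ideal_mult:
  assumes "x \<in> two_sided_ideal S"
  shows "a * x \<in> two_sided_ideal S" "x * a \<in> two_sided_ideal S"
proof -
  show "a * x \<in> two_sided_ideal S" using assms unfolding two_sided_ideal_def
  proof (rule span_mult_closed[rotated])
    fix s assume "s \<in> {a * s * b | a s b. s \<in> S}"
    then obtain b t c where s: "s = b * t * c" "t \<in> S" by auto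
    hence "a * s = (a * b) * t * c" by (simp add: mult.assoc)
    with s show "a * s \<in> calg.span {a * s * b | a s b. s \<in> S}"
      by (intro calg.span_base) blast
  qed (auto simp: algebra_simps mult_cscale_right)
  show "x * a \<in> two_sided_ideal S" using assms unfolding two_sided_ideal_def
  proof (rule span_mult_closed[rotated, where f = "\<lambda>x. x * a"])
    fix s assume "s \<in> {a * s * b | a s b. s \<in> S}"
    then obtain b t c where s: "s = b * t * c" "t \<in> S" by auto
    hence "s * a = b * t * (c * a)" by (simp add: mult.assoc)
    with s show "s * a \<in> calg.span {a * s * b | a s b. s \<in> S}"
      by (intro calg.span_base) blast
  qed (auto simp: algebra_simps mult_cscale_left)
qed


section \<open>The free algebra\<close>

datatype 'x word = Word (letters: "'x list")

instantiation word :: (type) monoid_add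
begin
definition zero_word :: "'a word" where "zero_word = Word []"
definition plus_word :: "'a word \<Rightarrow> 'a word \<Rightarrow> 'a word" where
  "plus_word u v = Word (letters u @ letters v)"
instance by standard (auto simp: zero_word_def plus_word_def)
end

type_synonym 'x free_algebra = "'x word \<Rightarrow>\<^sub>0 complex"

definition free_gen :: "'x \<Rightarrow> 'x free_algebra" where
  "free_gen x = Poly_Mapping.single (Word [x]) 1"

definition free_eval :: "('x \<Rightarrow> 'a) \<Rightarrow> 'x free_algebra \<Rightarrow> 'a :: complex_algebra_1" where
  "free_eval \<phi> = lin_ext (\<lambda>w. prod_list (map \<phi> (letters w)))"

lemma free_eval_simps [simp]:
  "free_eval \<phi> 0 = 0" "free_eval \<phi> 1 = 1" "free_eval \<phi> (free_gen x) = \<phi> x"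
  "free_eval \<phi> (p + q) = free_eval \<phi> p + free_eval \<phi> q"
  "free_eval \<phi> (p - q) = free_eval \<phi> p - free_eval \<phi> q"
  "free_eval \<phi> (p * q) = free_eval \<phi> p * free_eval \<phi> q"
  "free_eval \<phi> (c *\<^sub>C p) = c *\<^sub>C free_eval \<phi> p"
  by (simp_all add: free_eval_def free_gen_def lin_ext_add lin_ext_diff lin_ext_cscale lin_ext_mult
        plus_word_def zero_word_def cscale_one flip: single_one)

lemma free_eval_of_bool [simp]: "free_eval \<phi> (of_bool b) = of_bool b"
  by (cases b) auto

lemma free_eval_ideal:
  assumes "\<And>s. s \<in> S \<Longrightarrow> free_eval \<phi> s = 0" "p \<in> two_sided_ideal S"
  shows "free_eval \<phi> p = 0"
  using assms(2) unfolding two_sided_ideal_def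
  by (induction rule: calg.span_induct_alt) (auto simp: assms(1))


section \<open>The enveloping algebra of \<open>sl\<^sub>2\<close>\<close>

text \<open>
  The index set \<open>{1,2}\<close> is the numeral type \<^typ>\<open>2\<close>, whose two elements are \<open>1\<close> and \<open>2\<close>
  (\<open>2 = 0\<close> in this type).
\<close>

definition sl2_relations :: "(2 \<times> 2) free_algebra set" where
  "sl2_relations =
     {(let e = (\<lambda>i j. free_gen (i, j)) in
         (e i j * e k l - e k l * e i j) - (of_bool (j = k) * e i l - of_bool (l = i) * e k j)) | i j k l. True}
     \<union> {free_gen (1, 1) + free_gen (2, 2)}"

quotient_type U_sl2 = "(2 \<times> 2) free_algebra" / "\<lambda>x y. x - y \<in> two_sided_ideal sl2_relations"
  unfolding two_sided_ideal_def by (rule span_cong_equivp)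

instantiation U_sl2 :: complex_algebra_1
begin

lift_definition zero_U_sl2 :: U_sl2 is 0 .
lift_definition one_U_sl2 :: U_sl2 is 1 .
lift_definition plus_U_sl2 :: "U_sl2 \<Rightarrow> U_sl2 \<Rightarrow> U_sl2" is "(+)"
  unfolding two_sided_ideal_def by (rule span_cong_add)
lift_definition uminus_U_sl2 :: "U_sl2 \<Rightarrow> U_sl2" is uminus
  unfolding two_sided_ideal_def by (rule span_cong_minus)
lift_definition minus_U_sl2 :: "U_sl2 \<Rightarrow> U_sl2 \<Rightarrow> U_sl2" is "(-)"
  unfolding two_sided_ideal_def
  by (rule span_cong_diff)
lift_definition times_U_sl2 :: "U_sl2 \<Rightarrow> U_sl2 \<Rightarrow> U_sl2" is "(*)"
proof -
  fix a b c d :: "(2 \<times> 2) free_algebra"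
  assume "a - b \<in> two_sided_ideal sl2_relations" "c - d \<in> two_sided_ideal sl2_relations"
  hence "(a - b) * c + b * (c - d) \<in> two_sided_ideal sl2_relations"
    unfolding two_sided_ideal_def
    by (intro calg.span_add; fold two_sided_ideal_def) (auto intro: two_sided_ideal_mult)
  thus "a * c - b * d \<in> two_sided_ideal sl2_relations"
    by (simp add: algebra_simps)
qed
lift_definition cscale_U_sl2 :: "complex \<Rightarrow> U_sl2 \<Rightarrow> U_sl2" is "(*\<^sub>C)"
  unfolding two_sided_ideal_def by (rule span_cong_cscale)

instance
proof
  have "(1 :: (2 \<times> 2) free_algebra) \<notin> two_sided_ideal sl2_relations"
  proof
    assume "(1 :: (2 \<times> 2) free_algebra) \<in> two_sided_ideal sl2_relations"
    hence "free_eval (\<lambda>_. 0 :: complex) (1 :: (2 \<times> 2) free_algebra) = 0"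
      by (rule free_eval_ideal[rotated]) (auto simp: sl2_relations_def Let_def)
    thus False by simp
  qed
  moreover have "x \<in> two_sided_ideal sl2_relations" if "0 - x \<in> two_sided_ideal sl2_relations" for x
    using calg.span_neg[OF that[unfolded two_sided_ideal_def]] by (simp add: two_sided_ideal_def)
  ultimately show "(0 :: U_sl2) \<noteq> 1"
    by transfer auto
qed (transfer, unfold two_sided_ideal_def, rule span_cong_eqI,
     simp add: algebra_simps cscale_cscale cscale_one cscale_add_left cscale_add_right
       mult_cscale_left mult_cscale_right)+

end

lift_definition sl2_e :: "2 \<Rightarrow> 2 \<Rightarrow> U_sl2" is "\<lambda>i j. free_gen (i, j)" .

lemma sl2_e_commutator:
  "sl2_e i j * sl2_e k l - sl2_e k l * sl2_e i j =
     of_bool (j = k) * sl2_e i l - of_bool (l = i) * sl2_e k j"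
proof -
  have *: "free_gen (i, j) * free_gen (k, l) - free_gen (k, l) * free_gen (i, j)
       - (of_bool (j = k) * free_gen (i, l) - of_bool (l = i) * free_gen (k, j))
      \<in> two_sided_ideal sl2_relations" (is "?r \<in> _")
  proof -
    have "?r \<in> sl2_relations" by (auto simp: sl2_relations_def Let_def)
    hence "1 * ?r * 1 \<in> two_sided_ideal sl2_relations"
      unfolding two_sided_ideal_def by (intro calg.span_base) blast
    thus ?thesis by simp
  qed
  show ?thesis
    by (cases "j = k"; cases "l = i"; insert *; simp; transfer; simp)
qed

lemma sl2_e_trace: "sl2_e 1 1 + sl2_e 2 2 = 0"
proof transfer
  let ?r = "free_gen (1, 1) + free_gen (2, 2) :: (2 \<times> 2) free_algebra"
  have "?r \<in> sl2_relations" by (auto simp: sl2_relations_def)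
  hence "1 * ?r * 1 \<in> two_sided_ideal sl2_relations"
    unfolding two_sided_ideal_def by (intro calg.span_base) blast
  thus "?r - 0 \<in> two_sided_ideal sl2_relations" by simp
qed


section \<open>Tensor powers of algebras\<close>

text \<open>
  Families indexed by \<^typ>\<open>'n\<close> under componentwise multiplication, written additively so that
  finitely supported complex functions on them form the corresponding monoid algebra.
\<close>

datatype ('n, 'a) tuple = Tuple (entry: "'n \<Rightarrow> 'a")

instantiation tuple :: (type, monoid_mult) monoid_add
begin
definition zero_tuple :: "('a, 'b) tuple" where "zero_tuple = Tuple (\<lambda>_. 1)"
definition plus_tuple :: "('a, 'b) tuple \<Rightarrow> ('a, 'b) tuple \<Rightarrow> ('a, 'b) tuple" where
  "plus_tuple f g = Tuple (\<lambda>a. entry f a * entry g a)"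
instance by standard (auto simp: zero_tuple_def plus_tuple_def mult.assoc)
end

text \<open>
  The tensor power \<open>A\<^sup>\<otimes>\<^sup>n\<close> for \<open>n = CARD('n)\<close>, with tensor factors indexed by the finite type
  \<^typ>\<open>'n\<close> in place of \<open>{1..n}\<close>, is the vector space with basis all families in \<open>A\<close>, modulo the span of the multilinearity relations.
  The product is the componentwise one on pure tensors.
\<close>

definition tensor_relations :: "(('n, 'a :: complex_algebra_1) tuple \<Rightarrow>\<^sub>0 complex) set" where
  "tensor_relations =
     {Poly_Mapping.single (Tuple (f(a := x + y))) 1
        - (Poly_Mapping.single (Tuple (f(a := x))) 1 + Poly_Mapping.single (Tuple (f(a := y))) 1)
        | f a x y. True}
     \<union> {Poly_Mapping.single (Tuple (f(a := c *\<^sub>C x))) 1 - c *\<^sub>C Poly_Mapping.single (Tuple (f(a := x))) 1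
        | f a c x. True}"

lemma single_times_tensor_relation:
  fixes g :: "('n, 'a :: complex_algebra_1) tuple"
  assumes "s \<in> tensor_relations"
  shows "Poly_Mapping.single g 1 * s \<in> tensor_relations"
    and "s * Poly_Mapping.single g 1 \<in> tensor_relations"
proof -
  have L: "Poly_Mapping.single g 1 * Poly_Mapping.single (Tuple (f(a := x))) (1 :: complex) =
        Poly_Mapping.single (Tuple ((\<lambda>b. entry g b * f b)(a := entry g a * x))) 1" for f a x
    by (auto simp: mult_single plus_tuple_def intro!: arg_cong2[where f = Poly_Mapping.single])
  have R: "Poly_Mapping.single (Tuple (f(a := x))) 1 * Poly_Mapping.single g (1 :: complex) =
        Poly_Mapping.single (Tuple ((\<lambda>b. f b * entry g b)(a := x * entry g a))) 1" for f a x
    by (auto simp: mult_single plus_tuple_def intro!: arg_cong2[where f = Poly_Mapping.single])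
  from assms consider
    (1) f a x y where "s = Poly_Mapping.single (Tuple (f(a := x + y))) 1
        - (Poly_Mapping.single (Tuple (f(a := x))) 1 + Poly_Mapping.single (Tuple (f(a := y))) 1)"
  | (2) f a c x where "s = Poly_Mapping.single (Tuple (f(a := c *\<^sub>C x))) 1
        - c *\<^sub>C Poly_Mapping.single (Tuple (f(a := x))) 1"
    unfolding tensor_relations_def by blast
  note cases = this
  show "Poly_Mapping.single g 1 * s \<in> tensor_relations"
  proof (cases rule: cases)
    case 1
    show ?thesis unfolding 1 right_diff_distrib distrib_left L tensor_relations_def by blast
  next
    case 2
    show ?thesis unfolding 2 right_diff_distrib mult_cscale_right L tensor_relations_def by blast
  qed
  show "s * Poly_Mapping.single g 1 \<in> tensor_relations"
  proof (cases rule: cases)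
    case 1
    show ?thesis unfolding 1 left_diff_distrib distrib_right R tensor_relations_def by blast
  next
    case 2
    show ?thesis unfolding 2 left_diff_distrib mult_cscale_left R tensor_relations_def by blast
  qed
qed

lemma span_tensor_relations_mult:
  fixes x p :: "('n, 'a :: complex_algebra_1) tuple \<Rightarrow>\<^sub>0 complex"
  assumes "x \<in> calg.span tensor_relations"
  shows "p * x \<in> calg.span tensor_relations" "x * p \<in> calg.span tensor_relations"
proof -
  have single_scale: "Poly_Mapping.single m c = c *\<^sub>C Poly_Mapping.single m 1"
    for m :: "('n, 'a) tuple" and c :: complex
    by (intro poly_mapping_eqI) (simp add: lookup_single when_def cscale_complex_def)
  show "p * x \<in> calg.span tensor_relations"
  proof (induction p rule: poly_mapping_linear_induct)
    case (single m c)
    have "Poly_Mapping.single m 1 * x \<in> calg.span tensor_relations"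
      by (rule span_mult_closed[OF _ assms])
        (auto intro: calg.span_base single_times_tensor_relation simp: algebra_simps mult_cscale_right)
    thus ?case by (subst single_scale) (simp add: mult_cscale_left calg.span_scale)
  qed (auto simp: calg.span_zero algebra_simps intro: calg.span_add)
  show "x * p \<in> calg.span tensor_relations"
  proof (induction p rule: poly_mapping_linear_induct)
    case (single m c)
    have "x * Poly_Mapping.single m 1 \<in> calg.span tensor_relations"
      by (rule span_mult_closed[OF _ assms, where f = "\<lambda>x. x * Poly_Mapping.single m 1"])
        (auto intro: calg.span_base single_times_tensor_relation simp: algebra_simps mult_cscale_left)
    thus ?case by (subst single_scale) (simp add: mult_cscale_right calg.span_scale)
  qed (auto simp: calg.span_zero algebra_simps intro: calg.span_add)
qed

lemma ex_normalized_functional: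
  "\<exists>l :: 'a :: complex_algebra_1 \<Rightarrow> complex.
     l 1 = 1 \<and> (\<forall>x y. l (x + y) = l x + l y) \<and> (\<forall>c x. l (c *\<^sub>C x) = c * l x)"
proof -
  interpret vector_space_pair "cscale :: complex \<Rightarrow> 'a \<Rightarrow> 'a" "(*\<^sub>C) :: complex \<Rightarrow> complex \<Rightarrow> complex" ..
  have "calg.independent {1 :: 'a}"
    by simp
  then obtain g where g: "Vector_Spaces.linear (*\<^sub>C) (*\<^sub>C) g" "\<forall>x\<in>{1 :: 'a}. g x = (1 :: complex)"
    using linear_independent_extend[of "{1}" "\<lambda>_. 1"] by blast
  show ?thesis
    by (rule exI[of _ g]) (use g in \<open>auto simp: Vector_Spaces.linear.axioms linear_add linear_scale cscale_complex_def\<close>)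
qed

lemma one_notin_span_tensor_relations:
  "(1 :: ('n :: finite, 'a :: complex_algebra_1) tuple \<Rightarrow>\<^sub>0 complex) \<notin> calg.span tensor_relations"
proof
  obtain l :: "'a \<Rightarrow> complex"
    where l: "l 1 = 1" "\<And>x y. l (x + y) = l x + l y" "\<And>c x. l (c *\<^sub>C x) = c * l x"
    using ex_normalized_functional[where 'a = 'a] by blast
  define h :: "('n, 'a) tuple \<Rightarrow> complex" where "h = (\<lambda>t. \<Prod>a\<in>UNIV. l (entry t a))"
  have h: "h (Tuple (f(a := x))) = l x * (\<Prod>b\<in>UNIV - {a}. l (f b))" for f a x
    unfolding h_def by (subst prod.remove[of _ a]) (auto intro!: prod.cong)
  assume "(1 :: ('n, 'a) tuple \<Rightarrow>\<^sub>0 complex) \<in> calg.span tensor_relations"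
  hence "lin_ext h 1 = 0"
  proof (induction rule: calg.span_induct_alt)
    case (step c s p)
    have "lin_ext h s = 0"
      using step.hyps unfolding tensor_relations_def
      by (elim UnE CollectE exE conjE)
        (simp_all add: lin_ext_diff lin_ext_add lin_ext_cscale h l cscale_one cscale_complex_def
          distrib_right)
    with step.IH show ?case by (simp add: lin_ext_add lin_ext_cscale cscale_complex_def)
  qed auto
  moreover have "lin_ext h 1 = 1"
    by (simp add: h_def zero_tuple_def l cscale_one flip: single_one)
  ultimately show False by simp
qed

quotient_type (overloaded) ('a, 'n) tensor_power =
  "('n :: finite, 'a :: complex_algebra_1) tuple \<Rightarrow>\<^sub>0 complex" / "\<lambda>x y. x - y \<in> calg.span tensor_relations"
  by (rule span_cong_equivp)

instantiation tensor_power :: (complex_algebra_1, finite) complex_algebra_1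
begin

lift_definition zero_tensor_power :: "('a, 'b) tensor_power" is 0 .
lift_definition one_tensor_power :: "('a, 'b) tensor_power" is 1 .
lift_definition plus_tensor_power ::
  "('a, 'b) tensor_power \<Rightarrow> ('a, 'b) tensor_power \<Rightarrow> ('a, 'b) tensor_power" is "(+)"
  by (rule span_cong_add)
lift_definition uminus_tensor_power :: "('a, 'b) tensor_power \<Rightarrow> ('a, 'b) tensor_power" is uminus
  by (rule span_cong_minus)
lift_definition minus_tensor_power ::
  "('a, 'b) tensor_power \<Rightarrow> ('a, 'b) tensor_power \<Rightarrow> ('a, 'b) tensor_power" is "(-)"
  by (rule span_cong_diff)
lift_definition times_tensor_power ::
  "('a, 'b) tensor_power \<Rightarrow> ('a, 'b) tensor_power \<Rightarrow> ('a, 'b) tensor_power" is "(*)"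
proof -
  fix a b c d :: "('b, 'a) tuple \<Rightarrow>\<^sub>0 complex"
  assume "a - b \<in> calg.span tensor_relations" "c - d \<in> calg.span tensor_relations"
  hence "(a - b) * c + b * (c - d) \<in> calg.span tensor_relations"
    by (intro calg.span_add) (auto intro: span_tensor_relations_mult)
  thus "a * c - b * d \<in> calg.span tensor_relations"
    by (simp add: algebra_simps)
qed
lift_definition cscale_tensor_power :: "complex \<Rightarrow> ('a, 'b) tensor_power \<Rightarrow> ('a, 'b) tensor_power"
  is "(*\<^sub>C)"
  by (rule span_cong_cscale)

instance
proof
  have "x \<in> calg.span tensor_relations" if "0 - x \<in> calg.span tensor_relations"
    for x :: "('b, 'a) tuple \<Rightarrow>\<^sub>0 complex"
    using calg.span_neg[OF that] by simp
  thus "(0 :: ('a, 'b) tensor_power) \<noteq> 1"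
    by transfer (use one_notin_span_tensor_relations in blast)
qed (transfer, rule span_cong_eqI,
     simp add: algebra_simps cscale_cscale cscale_one cscale_add_left cscale_add_right
       mult_cscale_left mult_cscale_right)+

end

lift_definition pure_tensor :: "('n :: finite \<Rightarrow> 'a :: complex_algebra_1) \<Rightarrow> ('a, 'n) tensor_power"
  is "\<lambda>f. Poly_Mapping.single (Tuple f) 1" .

text \<open>\<open>x\<^sup>(\<^sup>a\<^sup>) = 1 \<otimes> \<dots> \<otimes> x \<otimes> \<dots> \<otimes> 1\<close> with \<open>x\<close> in position \<open>a\<close>\<close>

definition at_factor :: "'n :: finite \<Rightarrow> 'a :: complex_algebra_1 \<Rightarrow> ('a, 'n) tensor_power" where
  "at_factor a x = pure_tensor ((\<lambda>_. 1)(a := x))"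

lemma pure_tensor_mult: "pure_tensor f * pure_tensor g = pure_tensor (\<lambda>a. f a * g a)"
  by transfer (simp add: mult_single plus_tuple_def calg.span_zero)

lemma pure_tensor_add: "pure_tensor (f(a := x + y)) = pure_tensor (f(a := x)) + pure_tensor (f(a := y))"
  by transfer (rule calg.span_base, unfold tensor_relations_def, blast)

lemma pure_tensor_cscale: "pure_tensor (f(a := c *\<^sub>C x)) = c *\<^sub>C pure_tensor (f(a := x))"
  by transfer (rule calg.span_base, unfold tensor_relations_def, blast)

lemma at_factor_add: "at_factor a (x + y) = at_factor a x + at_factor a y"
  by (simp add: at_factor_def pure_tensor_add)

lemma at_factor_cscale: "at_factor a (c *\<^sub>C x) = c *\<^sub>C at_factor a x"
  by (simp add: at_factor_def pure_tensor_cscale)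

lemma at_factor_0 [simp]: "at_factor a 0 = 0"
  using at_factor_add[of a 0 0] by simp

lemma at_factor_diff: "at_factor a (x - y) = at_factor a x - at_factor a y"
  using at_factor_add[of a "x - y" y] by simp

lemma at_factor_1: "at_factor a 1 = 1"
  unfolding at_factor_def
  by transfer (rule span_cong_eqI, simp add: zero_tuple_def fun_upd_idem flip: single_one)

lemma at_factor_mult: "at_factor a (x * y) = at_factor a x * at_factor a y"
  by (auto simp: at_factor_def pure_tensor_mult fun_eq_iff intro!: arg_cong[where f = pure_tensor])

lemma at_factor_commute: "a \<noteq> b \<Longrightarrow> at_factor a x * at_factor b y = at_factor b y * at_factor a x"
  by (auto simp: at_factor_def pure_tensor_mult fun_eq_iff intro!: arg_cong[where f = pure_tensor])

lemma at_factor_of_bool: "at_factor a (of_bool b) = of_bool b"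
  by (cases b) (auto simp: at_factor_1)


section \<open>The diagonal embedding and the centralizer\<close>

lift_definition diag_emb :: "U_sl2 \<Rightarrow> (U_sl2, 'n :: finite) tensor_power"
  is "free_eval (\<lambda>(i, j). \<Sum>a\<in>UNIV. at_factor a (sl2_e i j))"
proof -
  fix p q :: "(2 \<times> 2) free_algebra"
  let ?D = "\<lambda>i j. \<Sum>a\<in>UNIV. at_factor (a :: 'n) (sl2_e i j)"
  have comm: "?D i j * ?D k l - ?D k l * ?D i j = of_bool (j = k) * ?D i l - of_bool (l = i) * ?D k j"
    for i j k l
  proof -
    have "?D i j * ?D k l - ?D k l * ?D i j = (\<Sum>a\<in>UNIV. \<Sum>b\<in>UNIV.
            at_factor (a :: 'n) (sl2_e i j) * at_factor b (sl2_e k l)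
            - at_factor b (sl2_e k l) * at_factor a (sl2_e i j))"
      unfolding sum_subtractf sum_product by (subst (2) sum.swap) (rule refl)
    also have "\<dots> = (\<Sum>a\<in>UNIV. \<Sum>b\<in>UNIV. if b = a then
            at_factor (a :: 'n) (sl2_e i j * sl2_e k l - sl2_e k l * sl2_e i j) else 0)"
      by (intro sum.cong refl) (auto simp: at_factor_commute at_factor_diff at_factor_mult)
    also have "\<dots> = (\<Sum>a\<in>UNIV. at_factor (a :: 'n)
            (of_bool (j = k) * sl2_e i l - of_bool (l = i) * sl2_e k j))"
      by (simp add: sl2_e_commutator)
    also have "\<dots> = of_bool (j = k) * ?D i l - of_bool (l = i) * ?D k j"
      by (simp add: at_factor_diff at_factor_mult at_factor_of_bool sum_subtractf sum_distrib_left
            del: of_bool_eq_0_iff)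
    finally show ?thesis .
  qed
  have trace: "?D 1 1 + ?D 2 2 = 0"
    by (simp add: sl2_e_trace flip: sum.distrib at_factor_add)
  assume "p - q \<in> two_sided_ideal sl2_relations"
  hence "free_eval (\<lambda>(i, j). ?D i j) (p - q) = 0"
  proof (rule free_eval_ideal[rotated])
    fix s assume "s \<in> sl2_relations"
    then consider (1) i j k l where
        "s = free_gen (i, j) * free_gen (k, l) - free_gen (k, l) * free_gen (i, j)
           - (of_bool (j = k) * free_gen (i, l) - of_bool (l = i) * free_gen (k, j))"
      | (2) "s = free_gen (1, 1) + free_gen (2, 2)"
      unfolding sl2_relations_def Let_def by blast
    thus "free_eval (\<lambda>(i, j). ?D i j) s = 0"
    proof cases
      case 1
      show ?thesis unfolding 1 free_eval_simps free_eval_of_bool prod.case comm by simp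
    next
      case 2
      show ?thesis unfolding 2 free_eval_simps prod.case trace ..
    qed
  qed
  thus "free_eval (\<lambda>(i, j). ?D i j) p = free_eval (\<lambda>(i, j). ?D i j) q"
    by simp
qed

lemma diag_emb_hom:
  "diag_emb 1 = 1" "diag_emb (x * y) = diag_emb x * diag_emb y"
  "diag_emb (x + y) = diag_emb x + diag_emb y" "diag_emb (c *\<^sub>C x) = c *\<^sub>C diag_emb x"
  by (transfer; simp)+

lemma diag_emb_sl2_e: "diag_emb (sl2_e i j) = (\<Sum>a\<in>UNIV. at_factor a (sl2_e i j))"
  by transfer simp

definition centralizer_sl2 :: "(U_sl2, 'n :: finite) tensor_power set" where
  "centralizer_sl2 = {X. \<forall>g. diag_emb g * X - X * diag_emb g = 0}"

text \<open>
  The elements of degree less than \<open>m\<close> are spanned by the monomials of length less than \<open>m\<close>; in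
  particular only \<open>0\<close> has degree less than \<open>0\<close>.
\<close>

definition degree_less :: "nat \<Rightarrow> (U_sl2, 'n :: finite) tensor_power set" where
  "degree_less m = calg.span
     {prod_list (map (\<lambda>(a, i, j). at_factor a (sl2_e i j)) w) | w. length w < m}"

definition degree_le :: "nat \<Rightarrow> (U_sl2, 'n :: finite) tensor_power set" where
  "degree_le m = calg.span
     {prod_list (map (\<lambda>(a, i, j). at_factor a (sl2_e i j)) w) | w. length w \<le> m}"


section \<open>The Hilbert--Poincare series\<close>

text \<open>\<open>V / W\<close> as a space of cosets, for subspaces \<open>W \<subseteq> V\<close>.\<close>

definition quotient_space ::
  "'a :: complex_algebra_1 set \<Rightarrow> 'a set \<Rightarrow> (complex, 'a set) module" where
  "quotient_space V W = \<lparr>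
     carrier = (\<lambda>x. (+) x ` W) ` V,
     mult = undefined, one = undefined,
     zero = W,
     add = (\<lambda>X Y. {x + y | x y. x \<in> X \<and> y \<in> Y}),
     smult = (\<lambda>c X. {c *\<^sub>C x + w | x w. x \<in> X \<and> w \<in> W})\<rparr>"

context
  fixes V W :: "'a :: complex_algebra_1 set"
  assumes V: "calg.subspace V" and W: "calg.subspace W" and WV: "W \<subseteq> V"
begin

lemma quotient_space_add:
  "(+) x ` W \<oplus>\<^bsub>quotient_space V W\<^esub> (+) y ` W = (+) (x + y) ` W"
proof -
  have "{a + b | a b. a \<in> (+) x ` W \<and> b \<in> (+) y ` W} = (+) (x + y) ` W" (is "?L = ?R")
  proof (intro equalityI subsetI)
    fix z assume "z \<in> ?L"
    then obtain u v where uv: "u \<in> W" "v \<in> W" "z = (x + u) + (y + v)" by blast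
    hence "z = (x + y) + (u + v)" by (simp add: algebra_simps)
    thus "z \<in> ?R" using calg.subspace_add[OF W uv(1,2)] by (rule image_eqI)
  next
    fix z assume "z \<in> ?R"
    then obtain w where w: "w \<in> W" "z = x + y + w" by blast
    hence "z = (x + w) + (y + 0)" by (simp add: algebra_simps)
    thus "z \<in> ?L" using w(1) calg.subspace_0[OF W] by blast
  qed
  thus ?thesis by (simp add: quotient_space_def)
qed

lemma quotient_space_smult:
  "c \<odot>\<^bsub>quotient_space V W\<^esub> ((+) x ` W) = (+) (c *\<^sub>C x) ` W"
proof -
  have "{c *\<^sub>C a + b | a b. a \<in> (+) x ` W \<and> b \<in> W} = (+) (c *\<^sub>C x) ` W" (is "?L = ?R")
  proof (intro equalityI subsetI)
    fix z assume "z \<in> ?L"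
    then obtain u v where uv: "u \<in> W" "v \<in> W" "z = c *\<^sub>C (x + u) + v" by blast
    hence "z = c *\<^sub>C x + (c *\<^sub>C u + v)" by (simp add: cscale_add_right add.assoc)
    thus "z \<in> ?R"
      using calg.subspace_add[OF W calg.subspace_scale[OF W uv(1)] uv(2)] by (rule image_eqI)
  next
    fix z assume "z \<in> ?R"
    then obtain w where w: "w \<in> W" "z = c *\<^sub>C x + w" by blast
    hence "z = c *\<^sub>C (x + 0) + w" by simp
    thus "z \<in> ?L" using w(1) calg.subspace_0[OF W] by blast
  qed
  thus ?thesis by (simp add: quotient_space_def)
qed

lemma vectorspace_quotient_space: "vectorspace class_ring (quotient_space V W)"
proof -
  let ?Q = "quotient_space V W"
  define C where "C = (\<lambda>x. (+) x ` W)"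
  have carrier: "carrier ?Q = C ` V"
    by (simp add: quotient_space_def C_def)
  have zero: "\<zero>\<^bsub>?Q\<^esub> = C 0"
    by (simp add: quotient_space_def C_def)
  have add: "C x \<oplus>\<^bsub>?Q\<^esub> C y = C (x + y)" for x y
    by (simp add: C_def quotient_space_add)
  have smult: "c \<odot>\<^bsub>?Q\<^esub> C x = C (c *\<^sub>C x)" for c x
    by (simp add: C_def quotient_space_smult)
  have "abelian_group ?Q"
  proof (rule abelian_groupI)
    fix X assume "X \<in> carrier ?Q"
    then obtain x where x: "x \<in> V" "X = C x" by (auto simp: carrier)
    have "C (- x) \<in> carrier ?Q"
      unfolding carrier by (intro imageI calg.subspace_neg[OF V] x)
    moreover have "C (- x) \<oplus>\<^bsub>?Q\<^esub> X = \<zero>\<^bsub>?Q\<^esub>"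
      unfolding x add zero by simp
    ultimately show "\<exists>Y\<in>carrier ?Q. Y \<oplus>\<^bsub>?Q\<^esub> X = \<zero>\<^bsub>?Q\<^esub>" ..
  qed (auto simp: carrier zero add add_ac
         intro!: imageI calg.subspace_add[OF V] calg.subspace_0[OF V])
  moreover have "field (class_ring :: complex ring)"
    by (rule class_field.field_axioms)
  moreover from this have "cring (class_ring :: complex ring)"
    by (simp add: field.axioms(1) domain.axioms(1))
  ultimately have "Module.module (class_ring :: complex ring) ?Q"
    by (intro module.intro module_axioms.intro)
      (auto simp: carrier smult add cscale_cscale cscale_one
         cscale_add_left cscale_add_right intro!: imageI calg.subspace_scale[OF V])
  thus ?thesis
    using \<open>field class_ring\<close> by (intro vectorspace.intro)
qed

end

lemma vectorspace_centralizer_degree: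
  "vectorspace class_ring (quotient_space (centralizer_sl2 \<inter> degree_le k :: (U_sl2, 'n :: finite) tensor_power set)
     (centralizer_sl2 \<inter> degree_less k))"
proof (rule vectorspace_quotient_space)
  have Z: "calg.subspace (centralizer_sl2 :: (U_sl2, 'n) tensor_power set)"
    by (rule calg.subspaceI)
      (auto simp: centralizer_sl2_def algebra_simps mult_cscale_left mult_cscale_right)
  show "calg.subspace (centralizer_sl2 \<inter> degree_le k :: (U_sl2, 'n) tensor_power set)"
    unfolding degree_le_def by (intro calg.subspace_inter Z calg.subspace_span)
  show "calg.subspace (centralizer_sl2 \<inter> degree_less k :: (U_sl2, 'n) tensor_power set)"
    unfolding degree_less_def by (intro calg.subspace_inter Z calg.subspace_span)
  show "centralizer_sl2 \<inter> degree_less k \<subseteq> (centralizer_sl2 \<inter> degree_le k :: (U_sl2, 'n) tensor_power set)"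
    unfolding degree_less_def degree_le_def by (intro Int_mono subset_refl calg.span_mono) auto
qed

definition hilbert_poincare_series :: "'n :: finite itself \<Rightarrow> rat fps" where
  "hilbert_poincare_series _ = Abs_fps (\<lambda>k. of_nat (vectorspace.dim class_ring
     (quotient_space (centralizer_sl2 \<inter> degree_le k :: (U_sl2, 'n) tensor_power set)
                     (centralizer_sl2 \<inter> degree_less k))))"

definition P_coeff :: "nat \<Rightarrow> nat \<Rightarrow> nat" where
  "P_coeff r m = (let k = m div 2 in
     if even m then (r choose k)\<^sup>2 else (r choose k) * (r choose (k + 1)))"

definition P_poly :: "nat \<Rightarrow> rat poly" where
  "P_poly r = [:1, 1:] ^ r * (\<Sum>k=0..2*r. monom ((-1) ^ k * of_nat (P_coeff r k)) k)"

end

theory Submission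
  imports Defs "HOL-Computational_Algebra.Formal_Laurent_Series"
begin

text \<open>
  Ordered monomials in \<open>e\<^sub>2\<^sub>1\<close>, \<open>e\<^sub>1\<^sub>1\<close>, \<open>e\<^sub>1\<^sub>2\<close> form a basis of \<open>U(sl\<^sub>2)\<close> (they are separated by Verma modules),
  so their tensor products form a basis of \<open>U(sl\<^sub>2)\<^sup>\<otimes>\<^sup>n\<close> that is compatible with the filtration and
  consists of weight vectors for the adjoint action of the diagonal \<open>e\<^sub>1\<^sub>1\<close>. The centralizer is the space
  of \<open>sl\<^sub>2\<close>-invariants of this action. On each filtration step, which is finite-dimensional, raising maps
  weight \<open>0\<close> onto weight \<open>1\<close> with kernel the invariants. Hence the coefficient of \<open>t\<^sup>k\<close> in the
  Hilbert--Poincare series is the number of basis elements of degree \<open>k\<close> and weight \<open>0\<close> minus the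
  number of those of degree \<open>k\<close> and weight \<open>1\<close>. With \<open>b\<^sub>A = (A+n-1 choose A)\<close> this gives
  \<open>(1-t)\<^bsup>-n\<^esup> (\<Sum>\<^sub>A b\<^sub>A\<^sup>2 t\<^bsup>2A\<^esup> - \<Sum>\<^sub>A b\<^sub>A b\<^bsub>A+1\<^esub> t\<^bsup>2A+1\<^esup>)\<close>, and Euler's transformation of the two
  hypergeometric series turns it into the stated rational function.
\<close>

section \<open>Binomial generating functions\<close>

definition binom_fps :: "nat \<Rightarrow> rat fps" where
  "binom_fps m = Abs_fps (\<lambda>A. of_nat ((A + m) choose m))"

text \<open>By Pascal's rule, multiplication by \<open>1 - fps_X\<close> lowers \<open>m\<close> by
  one, down to the geometric series. So \<open>binom_fps m\<close> is the expansion of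
  (1-t)^(-m-1).\<close>

lemma binom_fps_inverse: "binom_fps m * (1 - fps_X) ^ Suc m = 1"
proof (induction m)
  case 0
  show ?case
  proof (rule fps_ext)
    fix A show "fps_nth (binom_fps 0 * (1 - fps_X) ^ Suc 0) A = fps_nth 1 A"
      by (cases A) (simp_all add: binom_fps_def right_diff_distrib)
  qed
next
  case (Suc m)
  have "binom_fps (Suc m) * (1 - fps_X) = binom_fps m"
  proof (rule fps_ext)
    fix A show "fps_nth (binom_fps (Suc m) * (1 - fps_X)) A = fps_nth (binom_fps m) A"
      by (cases A) (simp_all add: binom_fps_def right_diff_distrib)
  qed
  thus ?case using Suc by (simp add: mult.assoc[symmetric])
qed

section \<open>Products of two binomial sequences and Euler's transformation\<close>

definition binom_prod_fps :: "nat \<Rightarrow> nat \<Rightarrow> nat \<Rightarrow> rat fps" where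
  "binom_prod_fps d q w =
     Abs_fps (\<lambda>A. of_nat (((A + (w + d)) choose (w + d)) * ((A + w + q) choose q)))"

definition binom_prod_numerator :: "nat \<Rightarrow> nat \<Rightarrow> nat \<Rightarrow> rat fps" where
  "binom_prod_numerator d q w = Abs_fps (\<lambda>k. of_nat ((d choose k) * ((q + w) choose (w + k))))"

text \<open>Apply Pascal's rule to the first binomial, then to the second one in the term where the
  first keeps its lower index. Three products result: the coefficient at A-1 of the same series,
  which the factor \<open>1 - fps_X\<close> cancels, and the two terms on the right.\<close>

lemma binom_prod_fps_rec:
  "binom_prod_fps (Suc d) (Suc q) w * (1 - fps_X) =
     fps_X * binom_prod_fps d q (Suc w) + binom_prod_fps d (Suc q) w"
proof (rule fps_ext)
  fix A
  show "fps_nth (binom_prod_fps (Suc d) (Suc q) w * (1 - fps_X)) A =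
     fps_nth (fps_X * binom_prod_fps d q (Suc w) + binom_prod_fps d (Suc q) w) A"
    by (cases A) (simp_all add: binom_prod_fps_def right_diff_distrib algebra_simps binomial_eq_0)
qed

text \<open>The same recurrence without the factor \<open>1 - fps_X\<close>, by Pascal's rule in
  \<open>d choose k\<close>. The two recurrences together drive the induction in
  \<open>binom_prod_fps_euler\<close>.\<close>

lemma binom_prod_numerator_rec:
  "binom_prod_numerator (Suc d) (Suc q) w =
     fps_X * binom_prod_numerator d q (Suc w) + binom_prod_numerator d (Suc q) w"
proof (rule fps_ext)
  fix k
  show "fps_nth (binom_prod_numerator (Suc d) (Suc q) w) k =
     fps_nth (fps_X * binom_prod_numerator d q (Suc w) + binom_prod_numerator d (Suc q) w) k"
    by (cases k) (simp_all add: binom_prod_numerator_def algebra_simps del: binomial_Suc_Suc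
        add: binomial_Suc_Suc[of d])
qed

text \<open>
  Euler's transformation: \<open>binom_prod_fps d q w\<close> is \<open>(w+q choose q)\<close> times the hypergeometric
  series \<open>\<^sub>2F\<^sub>1(w+d+1, w+q+1; w+1; t)\<close>.
\<close>

lemma binom_prod_fps_euler:
  "binom_prod_fps d q w * (1 - fps_X) ^ Suc (w + d + q) = binom_prod_numerator d q w"
proof (induction d arbitrary: q w)
  case 0
  \<comment> \<open>Both sides are the trinomial coefficient (A+w+q)! / (A! w! q!), so for
    \<open>d = 0\<close> the series is a constant multiple of a single binomial series.\<close>
  have "((A + w) choose w) * ((A + w + q) choose q) =
      ((w + q) choose w) * ((A + (w + q)) choose (w + q))" for A
  proof -
    have "real (((A + w) choose w) * ((A + w + q) choose q)) =
        real (((w + q) choose w) * ((A + (w + q)) choose (w + q)))"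
      by (simp add: binomial_fact divide_simps) (simp add: algebra_simps)
    thus ?thesis by (simp only: of_nat_eq_iff)
  qed
  hence "binom_prod_fps 0 q w = fps_const (of_nat ((w + q) choose w)) * binom_fps (w + q)"
    by (intro fps_ext) (simp add: binom_prod_fps_def binom_fps_def flip: of_nat_mult)
  moreover have "binom_prod_numerator 0 q w = fps_const (of_nat ((w + q) choose w))"
    by (rule fps_ext) (auto simp: binom_prod_numerator_def add.commute)
  ultimately show ?case
    using binom_fps_inverse[of "w + q"] by (simp add: mult.assoc)
next
  case (Suc d)
  note IH = Suc
  show ?case
  proof (cases q)
    case 0
    \<comment> \<open>The recurrence requires positive \<open>q\<close>. For \<open>q = 0\<close>
      the second binomial is 1 and the numerator reduces to its constant term.\<close>
    have "binom_prod_fps (Suc d) q w = binom_fps (w + Suc d)"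
      by (rule fps_ext) (simp add: binom_prod_fps_def binom_fps_def 0)
    moreover have "binom_prod_numerator (Suc d) q w = 1"
    proof (rule fps_ext)
      fix k show "fps_nth (binom_prod_numerator (Suc d) q w) k = fps_nth 1 k"
        by (cases k) (simp_all add: binom_prod_numerator_def 0)
    qed
    ultimately show ?thesis using binom_fps_inverse[of "w + Suc d"] by (simp add: 0)
  next
    case (Suc q')
    define Y :: "rat fps" where "Y = 1 - fps_X"
    have "binom_prod_fps (Suc d) q w * Y ^ Suc (w + Suc d + q) =
        (binom_prod_fps (Suc d) q w * Y) * Y ^ Suc (w + d + q)"
      by (simp add: mult_ac)
    \<comment> \<open>Lowering \<open>q\<close> while raising \<open>w\<close> keeps w + d + q, so
      both terms carry the exponent for which the induction hypothesis is available.\<close>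
    also have "\<dots> = fps_X * (binom_prod_fps d q' (Suc w) * Y ^ Suc (Suc w + d + q')) +
        binom_prod_fps d q w * Y ^ Suc (w + d + q)"
      unfolding Suc Y_def binom_prod_fps_rec by (simp add: algebra_simps)
    also have "\<dots> = binom_prod_numerator (Suc d) q w"
      unfolding Y_def IH by (simp add: Suc binom_prod_numerator_rec)
    finally show ?thesis unfolding Y_def .
  qed
qed

text \<open>Euler's transformation puts both series over the denominator (1-u)^(2s+1) with u = t^2.
  The combined numerator then contains (1-t)^2, which leaves (1-t)^(-r) from the factor
  \<open>binom_fps s\<close>; expanding by (1+t)^r turns this into a power of 1-u.\<close>

lemma hilbert_series_eq:
  fixes r :: nat
  defines "s \<equiv> Suc r"
  defines "G0 \<equiv> binom_prod_fps s s 0" and "G1 \<equiv> binom_prod_fps r s 1"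
  shows "binom_fps s * ((G0 oo fps_X ^ 2) - fps_X * (G1 oo fps_X ^ 2)) =
           fps_of_poly (P_poly r) / (1 - fps_X ^ 2) ^ (3 * (r + 1))"
proof -
  define u :: "rat fps" where "u = fps_X ^ 2"
  have u0: "fps_nth u 0 = 0" by (simp add: u_def)
  \<comment> \<open>\<open>Qe\<close> and \<open>Qo\<close> generate the even and the odd
    coefficients of the sum in \<open>P_poly\<close>, before signs.\<close>
  define Qe :: "rat fps" where "Qe = Abs_fps (\<lambda>k. of_nat ((r choose k)\<^sup>2))"
  define Qo :: "rat fps" where "Qo = Abs_fps (\<lambda>k. of_nat ((r choose k) * (r choose Suc k)))"
  \<comment> \<open>Pascal's rule for s = r+1: the square of C(r,k) + C(r,k-1) gives two shifted
    copies of \<open>Qe\<close> and a mixed term. For \<open>N1\<close> below, C(r+2,k+1) is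
    expanded twice.\<close>
  have N0: "binom_prod_numerator s s 0 = (1 + fps_X) * Qe + 2 * fps_X * Qo"
  proof (rule fps_ext)
    fix k show "fps_nth (binom_prod_numerator s s 0) k = fps_nth ((1 + fps_X) * Qe + 2 * fps_X * Qo) k"
      by (cases k) (simp_all add: binom_prod_numerator_def Qe_def Qo_def s_def distrib_right
          mult.assoc fps_numeral_fps_const power2_eq_square algebra_simps)
  qed
  have N1: "binom_prod_numerator r s 1 = (1 + fps_X) * Qo + 2 * Qe"
  proof (rule fps_ext)
    fix k show "fps_nth (binom_prod_numerator r s 1) k = fps_nth ((1 + fps_X) * Qo + 2 * Qe) k"
      by (cases k) (simp_all add: binom_prod_numerator_def Qe_def Qo_def s_def distrib_right
          fps_numeral_fps_const power2_eq_square algebra_simps)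
  qed
  have euler0: "(G0 oo u) * (1 - u) ^ (2 * s + 1) = (1 + u) * (Qe oo u) + 2 * u * (Qo oo u)"
  proof -
    have "G0 * (1 - fps_X) ^ (2 * s + 1) = (1 + fps_X) * Qe + 2 * fps_X * Qo"
      using binom_prod_fps_euler[of s s 0] unfolding G0_def N0 by (simp only: mult_2 add_0 add_Suc_right add_0_right One_nat_def)
    hence "(G0 * (1 - fps_X) ^ (2 * s + 1)) oo u = ((1 + fps_X) * Qe + 2 * fps_X * Qo) oo u"
      by (rule arg_cong)
    thus ?thesis
      by (simp only: fps_compose_mult_distrib[OF u0] fps_compose_add_distrib fps_compose_sub_distrib
          fps_compose_power[OF u0, symmetric] fps_compose_1 fps_X_fps_compose_startby0[OF u0]
          numeral_compose)
  qed
  have euler1: "(G1 oo u) * (1 - u) ^ (2 * s + 1) = (1 + u) * (Qo oo u) + 2 * (Qe oo u)"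
  proof -
    have "G1 * (1 - fps_X) ^ (2 * s + 1) = (1 + fps_X) * Qo + 2 * Qe"
      using binom_prod_fps_euler[of r s 1] unfolding G1_def N1 by (simp only: mult_2 s_def add_Suc add_Suc_right add_0 add_0_right One_nat_def)
    hence "(G1 * (1 - fps_X) ^ (2 * s + 1)) oo u = ((1 + fps_X) * Qo + 2 * Qe) oo u"
      by (rule arg_cong)
    thus ?thesis
      by (simp only: fps_compose_mult_distrib[OF u0] fps_compose_add_distrib fps_compose_sub_distrib
          fps_compose_power[OF u0, symmetric] fps_compose_1 fps_X_fps_compose_startby0[OF u0]
          numeral_compose)
  qed
  define Q where "Q = (Qe oo u) - fps_X * (Qo oo u)"
  have Q_nth: "fps_nth Q m = (-1) ^ m * of_nat (P_coeff r m)" for m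
  proof (cases m)
    case 0
    thus ?thesis by (simp add: Q_def u_def P_coeff_def Qe_def fps_nth_compose_X_power)
  next
    case (Suc m')
    show ?thesis
      by (cases "even m") (auto simp: Q_def u_def P_coeff_def Qe_def Qo_def Let_def Suc
          fps_nth_compose_X_power elim!: evenE oddE)
  qed
  \<comment> \<open>This makes the series \<open>Q\<close> agree with the polynomial sum, which
    stops at 2r.\<close>
  have P0: "P_coeff r m = 0" if "m > 2 * r" for m
    using that by (auto simp: P_coeff_def Let_def elim!: evenE oddE)
  have P: "fps_of_poly (P_poly r) = (1 + fps_X) ^ r * Q"
  proof -
    have "fps_of_poly (\<Sum>k=0..2*r. monom ((-1) ^ k * of_nat (P_coeff r k)) k) = Q"
    proof (rule fps_ext)
      fix m
      have "coeff (\<Sum>k=0..2*r. monom ((-1) ^ k * of_nat (P_coeff r k)) k) m =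
          (\<Sum>k=0..2*r. if k = m then (-1) ^ k * of_nat (P_coeff r k) else (0::rat))"
        by (simp add: coeff_sum)
      also have "\<dots> = fps_nth Q m"
        using P0[of m] by (auto simp: Q_nth sum.delta)
      finally show "fps_nth (fps_of_poly (\<Sum>k=0..2*r. monom ((-1) ^ k * of_nat (P_coeff r k)) k)) m
          = fps_nth Q m" by simp
    qed
    thus ?thesis
      by (simp add: P_poly_def fps_of_poly_mult fps_of_poly_power fps_of_poly_pCons)
  qed
  define B where "B = binom_fps s"
  define X :: "rat fps" where "X = fps_X"
  have uX: "u = X * X" by (simp add: u_def X_def power2_eq_square)
  have B: "B * (1 - X) ^ (r + 2) = 1"
    using binom_fps_inverse[of s] by (simp add: B_def X_def s_def)
  define D where "D = (G0 oo u) - X * (G1 oo u)"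
  have D: "D * (1 - u) ^ (2 * s + 1) = (1 - X) ^ 2 * Q"
  proof -
    have "D * (1 - u) ^ (2 * s + 1) =
        (G0 oo u) * (1 - u) ^ (2 * s + 1) - X * ((G1 oo u) * (1 - u) ^ (2 * s + 1))"
      by (simp only: D_def left_diff_distrib mult.assoc)
    \<comment> \<open>With u = X^2, both \<open>Qe\<close> and -X \<open>Qo\<close> acquire the same
      factor 1 - 2X + X^2.\<close>
    also have "\<dots> = (1 - X) ^ 2 * Q"
      unfolding euler0 euler1 Q_def unfolding X_def[symmetric] uX by (simp add: algebra_simps power2_eq_square)
    finally show ?thesis .
  qed
  have "B * D * (1 - u) ^ (3 * (r + 1)) = B * (D * (1 - u) ^ (2 * s + 1)) * (1 - u) ^ r"
  proof -
    have "3 * (r + 1) = 2 * s + 1 + r" by (simp add: s_def)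
    thus ?thesis by (simp only: power_add mult_ac)
  qed
  also have "(1 - u) ^ r = (1 - X) ^ r * (1 + X) ^ r"
    unfolding uX power_mult_distrib[symmetric] by (simp add: algebra_simps)
  also have "B * (D * (1 - u) ^ (2 * s + 1)) * \<dots> = B * (1 - X) ^ (r + 2) * ((1 + X) ^ r * Q)"
    unfolding D by (simp only: power_add mult_ac)
  also have "\<dots> = fps_of_poly (P_poly r)" unfolding B by (simp add: P X_def)
  finally have "B * D * (1 - u) ^ (3 * (r + 1)) = fps_of_poly (P_poly r)" .
  moreover have "(1 - u) ^ (3 * (r + 1)) \<noteq> 0"
  proof
    assume "(1 - u) ^ (3 * (r + 1)) = 0"
    hence "1 - u = 0" by simp
    hence "fps_nth (1 - u) 0 = 0" by simp
    thus False by (simp add: u0)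
  qed
  ultimately have "B * D = fps_of_poly (P_poly r) / (1 - u) ^ (3 * (r + 1))"
    by (metis nonzero_mult_div_cancel_right)
  thus ?thesis by (simp only: B_def D_def X_def u_def)
qed

section \<open>Counting exponent families by degree and weight\<close>

lemma card_functions_sum_eq:
  "card {g :: 'n :: finite \<Rightarrow> nat. sum g UNIV = s} = (s + CARD('n) - 1) choose s"
proof -
  obtain xs :: "'n list" where xs: "set xs = UNIV" "distinct xs"
    using finite_distinct_list[of "UNIV :: 'n set"] by auto
  have len: "length xs = CARD('n)" using distinct_card[OF xs(2)] xs(1) by simp
  have sum: "sum g UNIV = sum_list (map g xs)" for g :: "'n \<Rightarrow> nat"
    using sum_list_distinct_conv_sum_set[OF xs(2), of g] xs(1) by simp
  have "inj (\<lambda>g :: 'n \<Rightarrow> nat. map g xs)"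
    by (rule injI) (use xs(1) in \<open>auto simp: map_eq_conv\<close>)
  moreover have "(\<lambda>g. map g xs) ` {g :: 'n \<Rightarrow> nat. sum g UNIV = s} =
      {l. length l = CARD('n) \<and> sum_list l = s}"
  proof (intro equalityI subsetI)
    fix l :: "nat list" assume l: "l \<in> {l. length l = CARD('n) \<and> sum_list l = s}"
    define g where "g a = the (map_of (zip xs l) a)" for a
    have "map g xs = l"
      using l xs(2) len by (intro nth_equalityI) (auto simp: g_def map_of_zip_nth)
    thus "l \<in> (\<lambda>g. map g xs) ` {g. sum g UNIV = s}"
      using l by (intro image_eqI[of _ _ g]) (auto simp: sum)
  qed (auto simp: sum len)
  ultimately have "card {g :: 'n \<Rightarrow> nat. sum g UNIV = s} =
      card {l :: nat list. length l = CARD('n) \<and> sum_list l = s}"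
    by (metis (no_types, lifting) card_image inj_on_subset subset_UNIV)
  thus ?thesis by (simp add: card_length_sum_list)
qed


text \<open>A triple (i, j, k) holds the exponents of e21, e11 and e12 in one tensor factor, so this
  is the filtration degree of the ordered monomial.\<close>

definition pbw_degree :: "('n :: finite \<Rightarrow> nat \<times> nat \<times> nat) \<Rightarrow> nat" where
  "pbw_degree \<mu> = (\<Sum>a\<in>UNIV. case \<mu> a of (i, j, k) \<Rightarrow> i + j + k)"

text \<open>The eigenvalue of the monomial under the adjoint action of the diagonal e11, see
  \<open>diag_ad_pbw\<close>.\<close>

definition pbw_weight :: "('n :: finite \<Rightarrow> nat \<times> nat \<times> nat) \<Rightarrow> int" where
  "pbw_weight \<mu> = (\<Sum>a\<in>UNIV. case \<mu> a of (i, j, k) \<Rightarrow> int k - int i)"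

text \<open>Let A be the total exponent of e21. The weight forces total exponent A+w of e12, and the
  degree leaves k-(2A+w) for e11. For fixed A the three exponent functions are independent of each
  other, and each is counted by stars and bars.\<close>

lemma card_degree_weight:
  fixes w k :: nat
  shows "card {\<mu> :: 'n :: finite \<Rightarrow> _. pbw_degree \<mu> = k \<and> pbw_weight \<mu> = int w} =
    (\<Sum>A | 2 * A + w \<le> k. ((A + CARD('n) - 1) choose A) *
       (((k - (2 * A + w)) + CARD('n) - 1) choose (k - (2 * A + w))) *
       ((A + w + CARD('n) - 1) choose (A + w)))"
proof -
  define L where "L s = {g :: 'n \<Rightarrow> nat. sum g UNIV = s}" for s
  define I where "I = {A. 2 * A + w \<le> k}"
  have finI: "finite I" unfolding I_def by (rule finite_subset[of _ "{..k}"]) auto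
  \<comment> \<open>An infinite set has \<open>card\<close> 0, so finiteness follows from positivity
    of the binomial coefficient.\<close>
  have finL: "finite (L s)" for s
  proof (rule card_ge_0_finite)
    have "CARD('n) > 0" by simp
    hence "s \<le> s + CARD('n) - 1" by linarith
    thus "card (L s) > 0" by (simp add: L_def card_functions_sum_eq)
  qed
  define M where "M = {\<mu> :: 'n \<Rightarrow> _. pbw_degree \<mu> = k \<and> pbw_weight \<mu> = int w}"
  have deg: "pbw_degree \<mu> = (\<Sum>a\<in>UNIV. fst (\<mu> a)) + (\<Sum>a\<in>UNIV. fst (snd (\<mu> a))) + (\<Sum>a\<in>UNIV. snd (snd (\<mu> a)))"
    for \<mu> :: "'n \<Rightarrow> _"
    by (simp add: pbw_degree_def split_def sum.distrib)
  have wt: "pbw_weight \<mu> = int w \<longleftrightarrow> (\<Sum>a\<in>UNIV. snd (snd (\<mu> a))) = (\<Sum>a\<in>UNIV. fst (\<mu> a)) + w"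
    for \<mu> :: "'n \<Rightarrow> _"
  proof -
    have "pbw_weight \<mu> = int (\<Sum>a\<in>UNIV. snd (snd (\<mu> a))) - int (\<Sum>a\<in>UNIV. fst (\<mu> a))"
      by (simp add: pbw_weight_def split_def sum_subtractf)
    thus ?thesis by linarith
  qed
  have "bij_betw (\<lambda>\<mu>. (\<Sum>a\<in>UNIV. fst (\<mu> a), fst \<circ> \<mu>, fst \<circ> snd \<circ> \<mu>, snd \<circ> snd \<circ> \<mu>)) M
      (SIGMA A:I. L A \<times> L (k - (2 * A + w)) \<times> L (A + w))"
    by (rule bij_betw_byWitness[where f' = "\<lambda>(A, \<alpha>, \<beta>, \<gamma>) a. (\<alpha> a, \<beta> a, \<gamma> a)"])
      (auto simp: M_def I_def L_def deg wt fun_eq_iff)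
  hence "card M = card (SIGMA A:I. L A \<times> L (k - (2 * A + w)) \<times> L (A + w))"
    by (rule bij_betw_same_card)
  also have "\<dots> = (\<Sum>A\<in>I. card (L A) * card (L (k - (2 * A + w))) * card (L (A + w)))"
    using finI finL by (subst card_SigmaI) (auto simp: card_cartesian_product mult.assoc)
  finally show ?thesis
    by (simp add: M_def I_def L_def card_functions_sum_eq)
qed

text \<open>The sum over A is a convolution: \<open>binom_fps s\<close> counts the exponents of e11,
  and the other factor has b A * b (A + w) at position 2A+w. The bound \<open>w \<le> s\<close>
  gives w + (s - w) = s, so both binomials of \<open>binom_prod_fps (s - w) s w\<close> are values
  of \<open>b\<close>.\<close>

lemma card_degree_weight_fps:
  fixes w k :: nat
  assumes card: "CARD('n :: finite) = Suc s" and w: "w \<le> s"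
  shows "of_nat (card {\<mu> :: 'n \<Rightarrow> _. pbw_degree \<mu> = k \<and> pbw_weight \<mu> = int w}) =
    fps_nth (binom_fps s * (fps_X ^ w * (binom_prod_fps (s - w) s w oo fps_X ^ 2))) k"
proof -
  define b :: "nat \<Rightarrow> rat" where "b m = of_nat ((m + s) choose s)" for m
  have b: "of_nat ((m + CARD('n) - 1) choose m) = b m" for m
    by (simp add: card b_def binomial_symmetric[of m "m + s"])
  define h where "h = fps_X ^ w * (binom_prod_fps (s - w) s w oo fps_X ^ 2)"
  have h: "fps_nth h i = (if i \<ge> w \<and> even (i - w) then b ((i - w) div 2) * b ((i - w) div 2 + w) else 0)" for i
    using w by (auto simp: h_def fps_X_power_mult_nth fps_nth_compose_X_power binom_prod_fps_def b_def)
  have "fps_nth (binom_fps s * h) k = (\<Sum>i=0..k. fps_nth h i * b (k - i))"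
    by (subst mult.commute) (simp add: fps_mult_nth binom_fps_def b_def)
  also have "\<dots> = (\<Sum>i\<in>(\<lambda>A. 2 * A + w) ` {A. 2 * A + w \<le> k}. fps_nth h i * b (k - i))"
  proof (rule sum.mono_neutral_right)
    show "\<forall>i\<in>{0..k} - (\<lambda>A. 2 * A + w) ` {A. 2 * A + w \<le> k}. fps_nth h i * b (k - i) = 0"
    proof
      fix i assume i: "i \<in> {0..k} - (\<lambda>A. 2 * A + w) ` {A. 2 * A + w \<le> k}"
      have False if "i \<ge> w" "even (i - w)"
      proof -
        have "i = 2 * ((i - w) div 2) + w" using that by simp
        with i show False by auto
      qed
      thus "fps_nth h i * b (k - i) = 0" by (auto simp: h)
    qed
  qed auto
  also have "\<dots> = (\<Sum>A | 2 * A + w \<le> k. b A * b (k - (2 * A + w)) * b (A + w))"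
    by (subst sum.reindex) (auto simp: inj_on_def h intro!: sum.cong)
  also have "\<dots> = of_nat (card {\<mu> :: 'n \<Rightarrow> _. pbw_degree \<mu> = k \<and> pbw_weight \<mu> = int w})"
    unfolding card_degree_weight of_nat_sum of_nat_mult b ..
  finally show ?thesis by (simp only: h_def)
qed

section \<open>Linear algebra over the complex numbers\<close>

lemma calg_span_Int_0:
  fixes A B :: "'a :: complex_algebra_1 set"
  assumes ind: "calg.independent (A \<union> B)" and fin: "finite A" "finite B" and disj: "A \<inter> B = {}"
    and x: "x \<in> calg.span A" "x \<in> calg.span B"
  shows "x = 0"
proof -
  obtain u where u: "x = (\<Sum>v\<in>A. u v *\<^sub>C v)" using x(1) calg.span_finite[OF fin(1)] by auto
  obtain w where w: "x = (\<Sum>v\<in>B. w v *\<^sub>C v)" using x(2) calg.span_finite[OF fin(2)] by auto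
  define g where "g v = (if v \<in> A then u v else - w v)" for v
  have "(\<Sum>v\<in>A \<union> B. g v *\<^sub>C v) = (\<Sum>v\<in>A. g v *\<^sub>C v) + (\<Sum>v\<in>B. g v *\<^sub>C v)"
    by (rule sum.union_disjoint[OF fin disj])
  also have "(\<Sum>v\<in>A. g v *\<^sub>C v) = x" by (simp add: u g_def)
  also have "(\<Sum>v\<in>B. g v *\<^sub>C v) = (\<Sum>v\<in>B. - (w v *\<^sub>C v))"
    using disj by (intro sum.cong) (auto simp: g_def)
  also have "\<dots> = - x" by (simp add: w sum_negf)
  finally have "(\<Sum>v\<in>A \<union> B. g v *\<^sub>C v) = 0" by simp
  hence "g v = 0" if "v \<in> A" for v
    using calg.independentD[OF ind, of "A \<union> B" g v] fin that by auto
  thus ?thesis by (auto simp: u g_def)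
qed

text \<open>The dimension formulas for kernels, images and quotients below are all read off one
  basis of \<open>V\<close> that extends a basis of \<open>W\<close>.\<close>

lemma calg_basis_extend:
  fixes V W :: "'a :: complex_algebra_1 set"
  assumes V: "calg.subspace V" and W: "calg.subspace W" and WV: "W \<subseteq> V"
    and fin: "finite T" "V \<subseteq> calg.span T"
  obtains A B where "finite (A \<union> B)" "A \<inter> B = {}" "calg.independent (A \<union> B)"
    "calg.span A = W" "calg.span (A \<union> B) = V"
proof -
  obtain A where A: "A \<subseteq> W" "calg.independent A" "W \<subseteq> calg.span A"
    using calg.maximal_independent_subset by blast
  obtain C where C: "A \<subseteq> C" "C \<subseteq> V" "calg.independent C" "V \<subseteq> calg.span C"
    using calg.maximal_independent_subset_extend[of A V] A WV by blast
  have "finite C"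
    using calg.independent_span_bound[OF fin(1) C(3)] C(2) fin(2) by blast
  moreover have "calg.span A = W"
    using A W calg.span_minimal by blast
  moreover have "calg.span C = V"
    using C V calg.span_minimal by blast
  moreover have "A \<union> (C - A) = C" using C by blast
  ultimately show thesis
    using that[of A "C - A"] C(3) by auto
qed

text \<open>Take \<open>A\<close> spanning the kernel and \<open>A \<union> B\<close> spanning
  \<open>V\<close>. The spans of \<open>A\<close> and \<open>B\<close> meet only in 0, so
  \<open>f\<close> is injective on the span of \<open>B\<close> and maps \<open>B\<close> to a basis
  of the image.\<close>

lemma calg_rank_nullity:
  fixes f :: "'a :: complex_algebra_1 \<Rightarrow> 'b :: complex_algebra_1"
  assumes lin: "Vector_Spaces.linear (*\<^sub>C) (*\<^sub>C) f"
    and V: "calg.subspace V" and fin: "finite T" "V \<subseteq> calg.span T"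
  shows "calg.dim V = calg.dim (V \<inter> {v. f v = 0}) + calg.dim (f ` V)"
proof -
  interpret f: Vector_Spaces.linear "(*\<^sub>C)" "(*\<^sub>C)" f by (rule lin)
  interpret P: vector_space_pair "(*\<^sub>C) :: complex \<Rightarrow> 'a \<Rightarrow> 'a" "(*\<^sub>C) :: complex \<Rightarrow> 'b \<Rightarrow> 'b" ..
  let ?K = "V \<inter> {v. f v = 0}"
  have K: "calg.subspace ?K"
    using V by (auto simp: calg.subspace_def f.add f.scale)
  obtain A B where AB: "finite (A \<union> B)" "A \<inter> B = {}" "calg.independent (A \<union> B)"
    "calg.span A = ?K" "calg.span (A \<union> B) = V"
    using calg_basis_extend[OF V K _ fin] by blast
  have indA: "calg.independent A" and indB: "calg.independent B"
    using AB(3) calg.independent_mono by blast+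
  have inj: "inj_on f (calg.span B)"
  proof (rule f.inj_on_iff_eq_0[OF calg.subspace_span, THEN iffD2], safe)
    fix x assume x: "x \<in> calg.span B" "f x = 0"
    have "x \<in> V" using x(1) AB(5) calg.span_mono[of B "A \<union> B"] by blast
    with x AB(4) have "x \<in> calg.span A" by blast
    with x(1) show "x = 0" using calg_span_Int_0[OF AB(3)] AB(1,2) by blast
  qed
  have indfB: "calg.independent (f ` B)"
    using P.linear_independent_injective_image[OF lin indB inj] .
  have A0: "f ` A \<subseteq> {0}" using AB(4) calg.span_superset[of A] by auto
  have "f ` V = calg.span (f ` (A \<union> B))"
    using AB(5) P.linear_span_image[OF lin] by metis
  also have "\<dots> = calg.span (f ` B)"
  proof (rule antisym)
    have "f ` (A \<union> B) \<subseteq> insert 0 (f ` B)" using A0 by auto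
    from calg.span_mono[OF this] show "calg.span (f ` (A \<union> B)) \<subseteq> calg.span (f ` B)" by simp
    show "calg.span (f ` B) \<subseteq> calg.span (f ` (A \<union> B))" by (intro calg.span_mono) auto
  qed
  finally have "calg.dim (f ` V) = card (f ` B)"
    using calg.dim_span_eq_card_independent[OF indfB] by simp
  also have "\<dots> = card B"
    using inj calg.span_superset by (intro card_image inj_on_subset[OF inj]) auto
  finally have "calg.dim (f ` V) = card B" .
  moreover have "calg.dim ?K = card A"
    using calg.dim_span_eq_card_independent[OF indA] AB(4) by simp
  moreover have "calg.dim V = card A + card B"
    using calg.dim_span_eq_card_independent[OF AB(3)] AB(1,2,5) by (simp add: card_Un_disjoint)
  ultimately show ?thesis by simp
qed

text \<open>Links the dimension of the explicit space of cosets to \<open>calg.dim\<close>: the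
  cosets of the basis vectors outside \<open>W\<close> form a basis of the quotient.\<close>

lemma dim_quotient_space:
  fixes V W :: "'a :: complex_algebra_1 set"
  assumes V: "calg.subspace V" and W: "calg.subspace W" and WV: "W \<subseteq> V"
    and fin: "finite T" "V \<subseteq> calg.span T"
  shows "vectorspace.dim class_ring (quotient_space V W) + calg.dim W = calg.dim V"
proof -
  obtain A B where AB: "finite (A \<union> B)" "A \<inter> B = {}" "calg.independent (A \<union> B)"
    "calg.span A = W" "calg.span (A \<union> B) = V"
    using calg_basis_extend[OF V W WV fin] by blast
  have finB: "finite B" using AB(1) by simp
  have BV: "B \<subseteq> V" using AB(5) calg.span_superset by blast
  let ?Q = "quotient_space V W"
  define C where "C x = (+) x ` W" for x
  interpret Q: vectorspace class_ring ?Q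
    by (rule vectorspace_quotient_space[OF V W WV])
  have carrier: "carrier ?Q = C ` V"
    by (simp add: quotient_space_def C_def[abs_def])
  have zero: "\<zero>\<^bsub>?Q\<^esub> = C 0"
    by (simp add: quotient_space_def C_def)
  have add: "C x \<oplus>\<^bsub>?Q\<^esub> C y = C (x + y)" for x y
    by (simp add: C_def quotient_space_add[OF V W WV])
  have smult: "c \<odot>\<^bsub>?Q\<^esub> C x = C (c *\<^sub>C x)" for c x
    by (simp add: C_def quotient_space_smult[OF V W WV])
  have C_eq: "C x = C y \<longleftrightarrow> x - y \<in> W" for x y
  proof
    assume "C x = C y"
    moreover have "x \<in> C x" unfolding C_def using calg.subspace_0[OF W] by force
    ultimately obtain w where "w \<in> W" "x = y + w" unfolding C_def by blast
    thus "x - y \<in> W" by simp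
  next
    assume d: "x - y \<in> W"
    show "C x = C y" unfolding C_def
    proof safe
      fix w assume "w \<in> W"
      hence "x + w = y + ((x - y) + w)" "(x - y) + w \<in> W"
        using d calg.subspace_add[OF W] by auto
      thus "x + w \<in> (+) y ` W" by blast
    next
      fix w assume "w \<in> W"
      hence "y + w = x + (w - (x - y))" "w - (x - y) \<in> W"
        using d calg.subspace_diff[OF W] by auto
      thus "y + w \<in> (+) x ` W" by blast
    qed
  qed
  \<comment> \<open>Such a combination lies in the spans of both \<open>A\<close> and
    \<open>B\<close>, hence is 0. This gives injectivity of \<open>C\<close> on \<open>B\<close> as
    well as independence of the cosets.\<close>
  have combo0: "g v = 0" if "(\<Sum>b\<in>B. g b *\<^sub>C b) \<in> W" "v \<in> B" for g :: "'a \<Rightarrow> complex" and v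
  proof -
    have "(\<Sum>b\<in>B. g b *\<^sub>C b) \<in> calg.span B"
      by (intro calg.span_sum calg.span_scale calg.span_base)
    with that(1) have "(\<Sum>b\<in>B. g b *\<^sub>C b) = 0"
      using calg_span_Int_0[OF AB(3)] AB(1,2,4) by blast
    with that(2) show ?thesis
      using calg.independentD[OF AB(3) finB, of g v] by auto
  qed
  have inj: "inj_on C B"
  proof (rule inj_onI, rule ccontr)
    fix x y assume xy: "x \<in> B" "y \<in> B" "C x = C y" "x \<noteq> y"
    \<comment> \<open>The difference x - y written as a combination of \<open>B\<close>;
      \<open>combo0\<close> forces its coefficient 1 at \<open>x\<close> to vanish.\<close>
    have "(\<Sum>b\<in>B. (of_bool (b = x) - of_bool (b = y)) *\<^sub>C b) = x - y"
      using xy finB by (simp add: calg.scale_left_diff_distrib sum_subtractf of_bool_def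
          if_distrib[of "\<lambda>c. c *\<^sub>C _"] sum.delta cscale_one cong: if_cong)
    hence "(of_bool (x = x) - of_bool (x = y) :: complex) = 0"
      using xy(1,3) by (intro combo0) (simp_all add: C_eq)
    with xy(4) show False by simp
  qed
  have lincomb: "Q.lincomb a (C ` S) = C (\<Sum>b\<in>S. a (C b) *\<^sub>C b)" if "finite S" "S \<subseteq> B" for a S
    using that
  proof (induction S rule: finite_induct)
    case empty
    show ?case by (simp add: Q.lincomb_def zero)
  next
    case (insert x S)
    have [simp]: "carrier (class_ring :: complex ring) = UNIV" by simp
    have xV: "C x \<in> carrier ?Q" and SV: "C ` S \<subseteq> carrier ?Q"
      using insert.prems BV by (auto simp: carrier)
    have "C x \<notin> C ` S"
      using inj insert.hyps insert.prems by (auto dest: inj_onD)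
    hence "Q.lincomb a (insert (C x) (C ` S)) = a (C x) \<odot>\<^bsub>?Q\<^esub> C x \<oplus>\<^bsub>?Q\<^esub> Q.lincomb a (C ` S)"
      using insert.hyps xV SV by (intro Q.lincomb_insert2) auto
    thus ?case using insert by (simp add: add smult)
  qed
  have "Q.basis (C ` B)"
    unfolding Q.basis_def
  proof (intro conjI)
    show "C ` B \<subseteq> carrier ?Q" using BV by (auto simp: carrier)
    show "Q.lin_indpt (C ` B)"
    proof (rule Q.finite_lin_indpt2)
      fix a assume "Q.lincomb a (C ` B) = \<zero>\<^bsub>?Q\<^esub>"
      hence "(\<Sum>b\<in>B. a (C b) *\<^sub>C b) \<in> W"
        using lincomb[OF finB, of a] by (simp add: zero C_eq)
      from combo0[OF this] show "\<forall>v\<in>C ` B. a v = \<zero>\<^bsub>class_ring\<^esub>" by simp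
    qed (use finB BV in \<open>auto simp: carrier\<close>)
    show "Q.gen_set (C ` B)"
    proof
      show "Q.span (C ` B) \<subseteq> carrier ?Q"
        using BV by (intro Q.span_is_subset2) (auto simp: carrier)
      show "carrier ?Q \<subseteq> Q.span (C ` B)"
      proof
        fix X assume "X \<in> carrier ?Q"
        then obtain x where x: "x \<in> V" "X = C x" by (auto simp: carrier)
        then obtain u where u: "x = (\<Sum>v\<in>A \<union> B. u v *\<^sub>C v)"
          using AB(5) calg.span_finite[OF AB(1)] by auto
        \<comment> \<open>The coefficients are transported from \<open>B\<close> to the cosets along
          the inverse of \<open>C\<close>. The part of \<open>x\<close> over \<open>A\<close> lies
          in \<open>W\<close> and drops out.\<close>
        define a where "a Y = u (the_inv_into B C Y)" for Y
        have "x = (\<Sum>v\<in>A. u v *\<^sub>C v) + (\<Sum>v\<in>B. u v *\<^sub>C v)"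
          unfolding u using AB(1,2) by (intro sum.union_disjoint) auto
        moreover have "(\<Sum>v\<in>A. u v *\<^sub>C v) \<in> W"
          unfolding AB(4)[symmetric] by (intro calg.span_sum calg.span_scale calg.span_base)
        ultimately have "X = C (\<Sum>v\<in>B. u v *\<^sub>C v)"
          by (simp add: x C_eq)
        also have "(\<Sum>v\<in>B. u v *\<^sub>C v) = (\<Sum>v\<in>B. a (C v) *\<^sub>C v)"
          by (intro sum.cong refl) (simp add: a_def the_inv_into_f_f[OF inj])
        also have "C \<dots> = Q.lincomb a (C ` B)"
          by (rule lincomb[OF finB, symmetric]) simp
        finally show "X \<in> Q.span (C ` B)"
          unfolding Q.span_def using finB by auto
      qed
    qed
  qed
  hence "Q.dim = card (C ` B)"
    using finB by (intro Q.dim_basis) auto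
  also have "\<dots> = card B" by (rule card_image[OF inj])
  finally have "Q.dim = card B" .
  moreover have "calg.dim W = card A"
    using calg.dim_span_eq_card_independent[of A] AB(3,4) calg.independent_mono by blast
  moreover have "calg.dim V = card A + card B"
    using calg.dim_span_eq_card_independent[OF AB(3)] AB(1,2,5) by (simp add: card_Un_disjoint)
  ultimately show ?thesis by simp
qed

section \<open>Strings of raising and lowering operators\<close>

text \<open>Here \<open>H\<close> is half of the usual coroot, whence the relation with 2H. On a
  highest weight vector of weight 0, E F^(j+1) v = -j(j+1) F^j v. The scalar is nonzero for j > 0,
  so if F v were nonzero the string F^j v would never end.\<close>

lemma lowering_kills_invariant:
  fixes E F H :: "'a :: complex_algebra_1 \<Rightarrow> 'a"
  assumes lin: "Vector_Spaces.linear (*\<^sub>C) (*\<^sub>C) E" "Vector_Spaces.linear (*\<^sub>C) (*\<^sub>C) F"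
      "Vector_Spaces.linear (*\<^sub>C) (*\<^sub>C) H"
    and EF: "\<And>u. E (F u) = F (E u) + 2 *\<^sub>C H u" and HF: "\<And>u. H (F u) = F (H u) - F u"
    and v: "H v = 0" "E v = 0" "(F ^^ N) v = 0"
  shows "F v = 0"
proof (rule ccontr)
  interpret E: Vector_Spaces.linear "(*\<^sub>C)" "(*\<^sub>C)" E by fact
  interpret F: Vector_Spaces.linear "(*\<^sub>C)" "(*\<^sub>C)" F by fact
  interpret H: Vector_Spaces.linear "(*\<^sub>C)" "(*\<^sub>C)" H by fact
  assume nz: "F v \<noteq> 0"
  have HFj: "H ((F ^^ j) v) = (- of_nat j) *\<^sub>C (F ^^ j) v" for j
    by (induction j)
      (simp_all add: v HF F.scale F.neg calg.scale_left_distrib calg.scale_left_diff_distrib cscale_one)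
  have EFj: "E ((F ^^ Suc j) v) = (- of_nat (j * Suc j)) *\<^sub>C (F ^^ j) v" for j
  proof (induction j)
    case 0
    show ?case by (simp add: EF v F.zero)
  next
    case (Suc j)
    have "E ((F ^^ Suc (Suc j)) v) = F (E ((F ^^ Suc j) v)) + 2 *\<^sub>C H ((F ^^ Suc j) v)"
      by (simp add: EF)
    also have "\<dots> = (- of_nat (j * Suc j)) *\<^sub>C (F ^^ Suc j) v
        + (2 * (- of_nat (Suc j))) *\<^sub>C (F ^^ Suc j) v"
      unfolding Suc.IH HFj by (simp only: F.scale funpow.simps o_apply cscale_cscale)
    also have "\<dots> = (- of_nat (Suc j * Suc (Suc j))) *\<^sub>C (F ^^ Suc j) v"
      unfolding cscale_add_left[symmetric] by (simp add: algebra_simps)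
    finally show ?case .
  qed
  have "(F ^^ Suc j) v \<noteq> 0" for j
  proof (induction j)
    case (Suc j)
    hence "E ((F ^^ Suc (Suc j)) v) \<noteq> 0" unfolding EFj by (simp del: funpow.simps of_nat_mult of_nat_Suc)
    thus ?case using E.zero by force
  qed (use nz in simp)
  moreover have "(F ^^ Suc N) v = 0" using v(3) by (simp add: F.zero)
  ultimately show False by blast
qed

text \<open>If E F v = 0 for \<open>v\<close> of weight 1, then F E^(j+1) v = -(j+1)(j+2) E^j v with
  a nonzero scalar for every j, so a nonzero \<open>v\<close> would have an infinite string E^j v.
  Consequently E F is injective on weight 1, which later makes raising surjective from weight
  0.\<close>

lemma raising_lowering_injective:
  fixes E F H :: "'a :: complex_algebra_1 \<Rightarrow> 'a"
  assumes lin: "Vector_Spaces.linear (*\<^sub>C) (*\<^sub>C) E" "Vector_Spaces.linear (*\<^sub>C) (*\<^sub>C) F"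
      "Vector_Spaces.linear (*\<^sub>C) (*\<^sub>C) H"
    and EF: "\<And>u. E (F u) = F (E u) + 2 *\<^sub>C H u" and HE: "\<And>u. H (E u) = E (H u) + E u"
    and v: "H v = v" "E (F v) = 0" "(E ^^ N) v = 0"
  shows "v = 0"
proof (rule ccontr)
  interpret E: Vector_Spaces.linear "(*\<^sub>C)" "(*\<^sub>C)" E by fact
  interpret F: Vector_Spaces.linear "(*\<^sub>C)" "(*\<^sub>C)" F by fact
  interpret H: Vector_Spaces.linear "(*\<^sub>C)" "(*\<^sub>C)" H by fact
  assume nz: "v \<noteq> 0"
  have FE: "F (E u) = E (F u) - 2 *\<^sub>C H u" for u using EF[of u] by simp
  have HEj: "H ((E ^^ j) v) = (of_nat (Suc j)) *\<^sub>C (E ^^ j) v" for j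
  proof (induction j)
    case (Suc j)
    have "H ((E ^^ Suc j) v) = of_nat (Suc j) *\<^sub>C (E ^^ Suc j) v + 1 *\<^sub>C (E ^^ Suc j) v"
      by (simp add: HE Suc.IH E.scale cscale_one del: of_nat_Suc)
    thus ?case by (simp only: cscale_add_left[symmetric]) (simp add: add_ac)
  qed (simp add: v cscale_one)
  have FEj: "F ((E ^^ Suc j) v) = (- of_nat (Suc j * Suc (Suc j))) *\<^sub>C (E ^^ j) v" for j
  proof (induction j)
    case 0
    show ?case by (simp add: FE v calg.scale_minus_left)
  next
    case (Suc j)
    have "F ((E ^^ Suc (Suc j)) v) = E (F ((E ^^ Suc j) v)) - 2 *\<^sub>C H ((E ^^ Suc j) v)"
      by (simp add: FE)
    also have "\<dots> = (- of_nat (Suc j * Suc (Suc j))) *\<^sub>C (E ^^ Suc j) v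
        - (2 * (of_nat (Suc (Suc j)))) *\<^sub>C (E ^^ Suc j) v"
      unfolding Suc.IH HEj by (simp only: E.scale funpow.simps o_apply cscale_cscale)
    also have "\<dots> = (- of_nat (Suc (Suc j) * Suc (Suc (Suc j)))) *\<^sub>C (E ^^ Suc j) v"
      unfolding calg.scale_left_diff_distrib[symmetric] by (simp add: algebra_simps)
    finally show ?case .
  qed
  have "(E ^^ j) v \<noteq> 0" for j
  proof (induction j)
    case (Suc j)
    hence "F ((E ^^ Suc j) v) \<noteq> 0" unfolding FEj by (simp del: funpow.simps of_nat_mult of_nat_Suc)
    thus ?case using F.zero by force
  qed (use nz in simp)
  thus False using v(3) by blast
qed

section \<open>The enveloping algebra and its Poincare-Birkhoff-Witt basis\<close>

lemma exhaust_2: "i = 1 \<or> i = 2" for i :: 2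
proof (induction i)
  case (of_int z)
  hence "z = 0 \<or> z = 1" by auto
  thus ?case by auto
qed

lemma num2_cases: "P 1 \<Longrightarrow> P 2 \<Longrightarrow> P i" for i :: 2
  using exhaust_2[of i] by auto

lemma two_neq_one_2: "(2 :: 2) \<noteq> 1" "(1 :: 2) \<noteq> 2"
  by simp_all

abbreviation sl2_raise :: U_sl2 where "sl2_raise \<equiv> sl2_e 1 2"
abbreviation sl2_lower :: U_sl2 where "sl2_lower \<equiv> sl2_e 2 1"
abbreviation sl2_cartan :: U_sl2 where "sl2_cartan \<equiv> sl2_e 1 1"

lemma sl2_e_2_2: "sl2_e 2 2 = - sl2_cartan"
  using sl2_e_trace by (simp add: eq_neg_iff_add_eq_0 add.commute)

lemma sl2_commutators:
  "sl2_cartan * sl2_raise = sl2_raise * sl2_cartan + sl2_raise"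
  "sl2_cartan * sl2_lower = sl2_lower * sl2_cartan - sl2_lower"
  "sl2_raise * sl2_lower = sl2_lower * sl2_raise + 2 *\<^sub>C sl2_cartan"
proof -
  show "sl2_cartan * sl2_raise = sl2_raise * sl2_cartan + sl2_raise"
    using sl2_e_commutator[of 1 1 1 2] by (simp add: algebra_simps)
  show "sl2_cartan * sl2_lower = sl2_lower * sl2_cartan - sl2_lower"
    using sl2_e_commutator[of 1 1 2 1] by (simp add: algebra_simps)
  have "2 *\<^sub>C sl2_cartan = sl2_cartan + sl2_cartan"
    using cscale_add_left[of 1 1 sl2_cartan] by (simp add: cscale_one)
  thus "sl2_raise * sl2_lower = sl2_lower * sl2_raise + 2 *\<^sub>C sl2_cartan"
    using sl2_e_commutator[of 1 2 2 1] by (simp add: algebra_simps sl2_e_2_2)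
qed

text \<open>Every element is the class of a linear combination of words, and a word is built by
  multiplying letters from the left. Zero is covered as the scalar multiple 0 of 1.\<close>

lemma U_sl2_induct [case_names one cscale add mult]:
  assumes one: "P 1" and cscale: "\<And>c x. P x \<Longrightarrow> P (c *\<^sub>C x)"
    and add: "\<And>x y. P x \<Longrightarrow> P y \<Longrightarrow> P (x + y)"
    and mult: "\<And>i j x. P x \<Longrightarrow> P (sl2_e i j * x)"
  shows "P x"
proof -
  have "P (abs_U_sl2 p)" for p
  proof (induction p rule: poly_mapping_linear_induct)
    case zero
    have "P (0 *\<^sub>C 1)" by (intro cscale one)
    thus ?case by (simp add: zero_U_sl2.abs_eq)
  next
    case (single m c)
    have "P (abs_U_sl2 (Poly_Mapping.single (Word l) c))" for l
    proof (induction l)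
      case Nil
      have "Poly_Mapping.single (Word []) c = c *\<^sub>C (1 :: (2 \<times> 2) free_algebra)"
        by (rule poly_mapping_eqI)
          (simp add: lookup_single lookup_one zero_word_def when_def cscale_complex_def)
      thus ?case using cscale[OF one, of c] by (simp add: cscale_U_sl2.abs_eq one_U_sl2.abs_eq)
    next
      case (Cons x l)
      obtain i j where x: "x = (i, j)" by (cases x)
      have "Poly_Mapping.single (Word (x # l)) c = free_gen x * Poly_Mapping.single (Word l) c"
        by (simp add: free_gen_def mult_single plus_word_def)
      thus ?case using mult[OF Cons, of i j] by (simp add: times_U_sl2.abs_eq sl2_e.abs_eq x)
    qed
    thus ?case by (cases m) simp
  next
    case (add p q)
    thus ?case using assms(3) by (simp add: plus_U_sl2.abs_eq[symmetric])
  qed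
  thus ?thesis by (rule U_sl2.abs_induct)
qed


section \<open>Verma modules and the independence of ordered monomials\<close>

text \<open>
  The Verma module with basis \<open>v\<^sub>0, v\<^sub>1, \<dots>\<close> where \<open>e\<^sub>2\<^sub>1 v\<^sub>m = v\<^bsub>m+1\<^esub>\<close> and
  \<open>e\<^sub>1\<^sub>1 v\<^sub>m = (c - m) v\<^sub>m\<close>; a function \<open>\<psi>\<close> stands for the formal sum of all \<open>\<psi>(m) v\<^sub>m\<close>.
\<close>

definition verma_op :: "complex \<Rightarrow> 2 \<times> 2 \<Rightarrow> (nat \<Rightarrow> complex) \<Rightarrow> nat \<Rightarrow> complex" where
  "verma_op c x \<psi> m =
     (if x = (1, 1) then (c - of_nat m) * \<psi> m
      else if x = (2, 2) then - ((c - of_nat m) * \<psi> m)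
      else if x = (1, 2) then of_nat (Suc m) * (2 * c - of_nat m) * \<psi> (Suc m)
      else if m = 0 then 0 else \<psi> (m - 1))"

text \<open>Fixing the coordinate \<open>m\<close> keeps the linear extension complex valued. With
  \<open>foldr\<close> the last letter acts first, as in a left module.\<close>

definition verma_free :: "complex \<Rightarrow> (2 \<times> 2) free_algebra \<Rightarrow> (nat \<Rightarrow> complex) \<Rightarrow> nat \<Rightarrow> complex" where
  "verma_free c p \<psi> m = lin_ext (\<lambda>w. foldr (verma_op c) (letters w) \<psi> m) p"

lemma verma_op_simps:
  "verma_op c (1, 1) \<psi> m = (c - of_nat m) * \<psi> m"
  "verma_op c (2, 2) \<psi> m = - ((c - of_nat m) * \<psi> m)"
  "verma_op c (1, 2) \<psi> m = of_nat (Suc m) * (2 * c - of_nat m) * \<psi> (Suc m)"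
  "verma_op c (2, 1) \<psi> 0 = 0" "verma_op c (2, 1) \<psi> (Suc m) = \<psi> m"
  by (simp_all add: verma_op_def)

lemma verma_op_commutator:
  "verma_op c (i, j) (verma_op c (k, l) \<psi>) m - verma_op c (k, l) (verma_op c (i, j) \<psi>) m =
     of_bool (j = k) * verma_op c (i, l) \<psi> m - of_bool (l = i) * verma_op c (k, j) \<psi> m"
  by (rule num2_cases[of _ i]; rule num2_cases[of _ j]; rule num2_cases[of _ k];
      rule num2_cases[of _ l]; cases m;
      simp only: verma_op_simps two_neq_one_2 of_bool_def refl if_True if_False of_nat_Suc of_nat_0;
      simp add: algebra_simps)

lemma verma_op_add: "verma_op c x (\<lambda>m. \<psi> m + \<phi> m) = (\<lambda>m. verma_op c x \<psi> m + verma_op c x \<phi> m)"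
  by (auto simp: verma_op_def fun_eq_iff algebra_simps)

lemma verma_op_scale: "verma_op c x (\<lambda>m. d * \<psi> m) = (\<lambda>m. d * verma_op c x \<psi> m)"
  by (auto simp: verma_op_def fun_eq_iff algebra_simps)

lemma verma_ops_add: "foldr (verma_op c) w (\<lambda>m. \<psi> m + \<phi> m) =
    (\<lambda>m. foldr (verma_op c) w \<psi> m + foldr (verma_op c) w \<phi> m)"
  by (induction w) (simp_all add: verma_op_add)

lemma verma_ops_scale: "foldr (verma_op c) w (\<lambda>m. d * \<psi> m) = (\<lambda>m. d * foldr (verma_op c) w \<psi> m)"
  by (induction w) (simp_all add: verma_op_scale)

lemma verma_free_add: "verma_free c (p + q) \<psi> = (\<lambda>m. verma_free c p \<psi> m + verma_free c q \<psi> m)"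
  by (simp add: verma_free_def lin_ext_add fun_eq_iff)

lemma verma_free_diff: "verma_free c (p - q) \<psi> = (\<lambda>m. verma_free c p \<psi> m - verma_free c q \<psi> m)"
  by (simp add: verma_free_def lin_ext_diff fun_eq_iff)

lemma verma_free_scale: "verma_free c (d *\<^sub>C p) \<psi> = (\<lambda>m. d * verma_free c p \<psi> m)"
  by (simp add: verma_free_def lin_ext_cscale cscale_complex_def fun_eq_iff)

lemma verma_free_0: "verma_free c 0 \<psi> = (\<lambda>m. 0)"
  by (simp add: verma_free_def fun_eq_iff)

lemma verma_free_1: "verma_free c 1 \<psi> = \<psi>"
  by (simp add: verma_free_def fun_eq_iff zero_word_def cscale_one flip: single_one)

lemma verma_free_gen: "verma_free c (free_gen x) \<psi> = verma_op c x \<psi>"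
  by (simp add: verma_free_def free_gen_def fun_eq_iff cscale_one)

lemma verma_free_single:
  "verma_free c (Poly_Mapping.single w d) \<psi> = (\<lambda>m. d * foldr (verma_op c) (letters w) \<psi> m)"
  by (simp add: verma_free_def fun_eq_iff cscale_complex_def)

lemma verma_free_mult: "verma_free c (p * q) \<psi> = verma_free c p (verma_free c q \<psi>)"
proof (induction p rule: poly_mapping_linear_induct)
  case (single w d)
  show ?case
  proof (induction q rule: poly_mapping_linear_induct)
    case zero
    show ?case using verma_ops_scale[of c "letters w" 0 "\<lambda>_. 0"]
      by (simp add: verma_free_single verma_free_0)
  next
    case (single w' d')
    show ?case by (simp add: mult_single verma_free_single verma_ops_scale plus_word_def mult.assoc)
  next
    case (add q r)
    show ?case unfolding distrib_left verma_free_add add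
      by (simp add: verma_free_single verma_ops_add algebra_simps)
  qed
qed (simp_all add: distrib_right verma_free_add verma_free_0)

lemma verma_free_zero_vector: "verma_free c p (\<lambda>m. 0) = (\<lambda>m. 0)"
proof (induction p rule: poly_mapping_linear_induct)
  case (single w d)
  show ?case using verma_ops_scale[of c "letters w" 0 "\<lambda>_. 0"] by (simp add: verma_free_single)
qed (simp_all add: verma_free_add verma_free_0)

lemma verma_free_relation:
  assumes "s \<in> sl2_relations"
  shows "verma_free c s \<psi> = (\<lambda>m. 0)"
proof -
  have of_bool: "verma_free c (of_bool b * p) \<psi> = (\<lambda>m. of_bool b * verma_free c p \<psi> m)" for b p
    by (cases b) (simp_all add: verma_free_0)
  from assms consider (1) i j k l where
      "s = free_gen (i, j) * free_gen (k, l) - free_gen (k, l) * free_gen (i, j)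
         - (of_bool (j = k) * free_gen (i, l) - of_bool (l = i) * free_gen (k, j))"
    | (2) "s = free_gen (1, 1) + free_gen (2, 2)"
    unfolding sl2_relations_def Let_def by blast
  thus ?thesis
  proof cases
    case 1
    have "verma_free c s \<psi> m = 0" for m
      unfolding 1 verma_free_diff of_bool
      by (simp only: verma_free_mult verma_free_gen verma_op_commutator diff_self)
    thus ?thesis by blast
  next
    case 2
    show ?thesis unfolding 2 verma_free_add verma_free_gen by (simp add: verma_op_def fun_eq_iff)
  qed
qed

lemma verma_free_ideal:
  assumes "p \<in> two_sided_ideal sl2_relations"
  shows "verma_free c p \<psi> = (\<lambda>m. 0)"
  using assms unfolding two_sided_ideal_def
proof (induction rule: calg.span_induct_alt)
  case (step d x y)
  then obtain a s b where "x = a * s * b" "s \<in> sl2_relations" by auto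
  thus ?case using step.IH
    by (simp add: verma_free_add verma_free_scale verma_free_mult verma_free_relation
        verma_free_zero_vector)
qed (simp add: verma_free_0)

lift_definition verma :: "complex \<Rightarrow> U_sl2 \<Rightarrow> (nat \<Rightarrow> complex) \<Rightarrow> nat \<Rightarrow> complex" is verma_free
proof -
  fix c and p q :: "(2 \<times> 2) free_algebra"
  assume "p - q \<in> two_sided_ideal sl2_relations"
  hence "verma_free c (p - q) \<psi> m = 0" for \<psi> m by (simp add: verma_free_ideal)
  thus "verma_free c p = verma_free c q" by (auto simp: verma_free_diff fun_eq_iff)
qed

lemma verma_simps:
  "verma c 0 \<psi> m = 0" "verma c 1 \<psi> = \<psi>"
  "verma c (x + y) \<psi> m = verma c x \<psi> m + verma c y \<psi> m"
  "verma c (d *\<^sub>C x) \<psi> m = d * verma c x \<psi> m"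
  "verma c (x * y) \<psi> = verma c x (verma c y \<psi>)"
  "verma c (sl2_e i j) \<psi> = verma_op c (i, j) \<psi>"
  by (transfer; simp add: verma_free_0 verma_free_1 verma_free_add verma_free_scale
        verma_free_mult verma_free_gen)+

lemma verma_sum: "verma c (\<Sum>t\<in>T. g t) \<psi> m = (\<Sum>t\<in>T. verma c (g t) \<psi> m)"
  by (induction T rule: infinite_finite_induct) (simp_all add: verma_simps)

lemma verma_vector_scale: "verma c x (\<lambda>m. d * \<psi> m) = (\<lambda>m. d * verma c x \<psi> m)"
proof (induction x rule: U_sl2_induct)
  case (mult i j x)
  show ?case by (simp only: verma_simps(5,6) mult verma_op_scale)
next
  case (cscale e x)
  thus ?case by (simp only: fun_eq_iff verma_simps(4)) simp
next
  case (add x y)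
  thus ?case by (simp only: fun_eq_iff verma_simps(3) distrib_left) simp
qed (simp add: verma_simps)

fun pbw_mono :: "nat \<times> nat \<times> nat \<Rightarrow> U_sl2" where
  "pbw_mono (i, j, k) = sl2_lower ^ i * sl2_cartan ^ j * sl2_raise ^ k"

text \<open>Indicator functions are the basis vectors, and e12 sends v_(m+1) to (m+1)(2c-m) v_m. A
  negative integer \<open>c\<close> keeps 2c-m nonzero, so e12^m moves v_m to a nonzero multiple of
  v_0; one more step gives 0.\<close>

lemma verma_raise_power:
  assumes "c = - of_nat (Suc n)"
  shows "k > m \<Longrightarrow> verma c (sl2_raise ^ k) (\<lambda>l. of_bool (l = m)) = (\<lambda>l. 0)"
    and "\<exists>K. K \<noteq> 0 \<and> verma c (sl2_raise ^ m) (\<lambda>l. of_bool (l = m)) = (\<lambda>l. K * of_bool (l = 0))"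
proof -
  have step: "verma c sl2_raise (\<lambda>l. of_bool (l = Suc m)) =
      (\<lambda>l. (of_nat (Suc m) * (2 * c - of_nat m)) * of_bool (l = m))" for m
    by (auto simp: verma_simps verma_op_def fun_eq_iff)
  have step0: "verma c sl2_raise (\<lambda>l. of_bool (l = 0)) = (\<lambda>l. 0 * of_bool (l = 0))"
    by (auto simp: verma_simps verma_op_def fun_eq_iff)
  show "k > m \<Longrightarrow> verma c (sl2_raise ^ k) (\<lambda>l. of_bool (l = m)) = (\<lambda>l. 0)"
  proof (induction k arbitrary: m)
    case (Suc k)
    show ?case
    proof (cases m)
      case 0
      show ?thesis
        by (simp only: power_Suc2 verma_simps(5) 0 step0 verma_vector_scale) simp
    next
      case (Suc m')
      thus ?thesis using Suc.IH[of m'] Suc.prems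
        by (simp only: power_Suc2 verma_simps(5) step verma_vector_scale) simp
    qed
  qed simp
  show "\<exists>K. K \<noteq> 0 \<and> verma c (sl2_raise ^ m) (\<lambda>l. of_bool (l = m)) = (\<lambda>l. K * of_bool (l = 0))"
  proof (induction m)
    case 0
    show ?case by (rule exI[of _ 1]) (simp add: verma_simps)
  next
    case (Suc m)
    then obtain K where K: "K \<noteq> 0"
        "verma c (sl2_raise ^ m) (\<lambda>l. of_bool (l = m)) = (\<lambda>l. K * of_bool (l = 0))" by blast
    have "2 * c - of_nat m = - of_nat (2 * Suc n + m)" by (simp add: assms)
    hence "2 * c - of_nat m \<noteq> 0" by (simp only: neg_equal_0_iff_equal of_nat_eq_0_iff) simp
    thus ?case using K(1)
      by (intro exI[of _ "of_nat (Suc m) * (2 * c - of_nat m) * K"])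
        (simp add: power_Suc2 verma_simps(5) step verma_vector_scale K(2) mult.assoc
          del: power_Suc of_nat_Suc)
  qed
qed

lemma verma_cartan_lower_power:
  "verma c (sl2_lower ^ i * sl2_cartan ^ j) (\<lambda>l. of_bool (l = 0)) = (\<lambda>l. c ^ j * of_bool (l = i))"
proof -
  have "verma c (sl2_cartan ^ j) (\<lambda>l. of_bool (l = 0)) = (\<lambda>l. c ^ j * of_bool (l = 0))"
    by (induction j) (auto simp: verma_simps verma_op_def fun_eq_iff)
  moreover have "verma c (sl2_lower ^ i) (\<lambda>l. of_bool (l = 0)) = (\<lambda>l. of_bool (l = i))"
    by (induction i) (auto simp: verma_simps verma_op_def fun_eq_iff)
  ultimately show ?thesis by (simp add: verma_simps verma_vector_scale)
qed

text \<open>Let m be the least exponent of e12 among the terms with nonzero coefficient. Acting on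
  v_m kills all terms with a larger exponent and sends e21^i e11^j e12^m to K c^j v_i. Each
  coordinate is then a polynomial in \<open>c\<close> vanishing at all negative integers, hence
  zero.\<close>

lemma pbw_mono_independent:
  assumes fin: "finite S" and sum: "(\<Sum>t\<in>S. x t *\<^sub>C pbw_mono t) = 0" and t: "t \<in> S"
  shows "x t = 0"
proof (rule ccontr)
  assume nz: "x t \<noteq> 0"
  define T where "T = {t \<in> S. x t \<noteq> 0}"
  have finT: "finite T" using fin by (simp add: T_def)
  have "t \<in> T" using t nz by (simp add: T_def)
  define m where "m = Min ((\<lambda>(i, j, k). k) ` T)"
  have "m \<in> (\<lambda>(i, j, k). k) ` T"
    unfolding m_def using finT \<open>t \<in> T\<close> by (intro Min_in) auto
  then obtain i0 j0 where t0: "(i0, j0, m) \<in> T" by auto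
  have m_le: "m \<le> k" if "(i, j, k) \<in> T" for i j k
    unfolding m_def using finT that by (intro Min_le) force+
  \<comment> \<open>Exactly the terms that contribute to the coordinate \<open>i0\<close> of the
    image of v_m; they differ only in the exponent of e11.\<close>
  define T' where "T' = {t \<in> T. \<exists>j. t = (i0, j, m)}"
  have finT': "finite T'" using finT by (simp add: T'_def)
  \<comment> \<open>The coordinate at \<open>i0\<close> is \<open>K * poly p c\<close>, where
    \<open>K\<close> may depend on \<open>c\<close> but is never zero.\<close>
  define p where "p = (\<Sum>t\<in>T'. monom (x t) (fst (snd t)))"
  have "poly p c = 0" if c: "c = - of_nat (Suc n)" for c n
  proof -
    obtain K where K: "K \<noteq> 0"
        "verma c (sl2_raise ^ m) (\<lambda>l. of_bool (l = m)) = (\<lambda>l. K * of_bool (l = 0))"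
      using verma_raise_power(2)[OF c] by blast
    have val: "verma c (pbw_mono t) (\<lambda>l. of_bool (l = m)) i0 =
        (if t \<in> T' then K * c ^ fst (snd t) else 0)" if "t \<in> T" for t
    proof -
      obtain i j k where ijk: "t = (i, j, k)" by (cases t)
      show ?thesis
      proof (cases "k = m")
        case True
        thus ?thesis using that unfolding ijk T'_def
          by (auto simp: verma_simps(5)[of _ "_ * _"] K(2) verma_vector_scale verma_cartan_lower_power)
      next
        case False
        hence "k > m" using m_le[of i j k] that ijk by simp
        moreover have "verma c (sl2_lower ^ i * sl2_cartan ^ j) (\<lambda>l. 0) = (\<lambda>l. 0)"
          using verma_vector_scale[of c _ 0 "\<lambda>_. 0"] by simp
        ultimately show ?thesis
          using False verma_raise_power(1)[OF c] unfolding ijk T'_def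
          by (simp add: verma_simps(5)[of _ "_ * _"])
      qed
    qed
    have "0 = verma c (\<Sum>t\<in>S. x t *\<^sub>C pbw_mono t) (\<lambda>l. of_bool (l = m)) i0"
      by (simp add: sum verma_simps)
    also have "\<dots> = (\<Sum>t\<in>S. x t * verma c (pbw_mono t) (\<lambda>l. of_bool (l = m)) i0)"
      by (simp add: verma_sum verma_simps)
    also have "\<dots> = (\<Sum>t\<in>T'. x t * (K * c ^ fst (snd t)))"
    proof (rule sum.mono_neutral_cong_right[OF fin])
      show "T' \<subseteq> S" by (auto simp: T'_def T_def)
      show "\<forall>t\<in>S - T'. x t * verma c (pbw_mono t) (\<lambda>l. of_bool (l = m)) i0 = 0"
      proof
        fix t assume "t \<in> S - T'"
        thus "x t * verma c (pbw_mono t) (\<lambda>l. of_bool (l = m)) i0 = 0"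
          using val[of t] by (cases "x t = 0") (auto simp: T_def)
      qed
      show "x t * verma c (pbw_mono t) (\<lambda>l. of_bool (l = m)) i0 = x t * (K * c ^ fst (snd t))"
        if "t \<in> T'" for t
      proof -
        have "t \<in> T" using that by (simp add: T'_def)
        thus ?thesis using val[of t] that by simp
      qed
    qed
    also have "\<dots> = K * poly p c"
      by (simp add: p_def poly_sum poly_monom sum_distrib_left mult_ac)
    finally show ?thesis using K(1) by simp
  qed
  hence "range (\<lambda>n. - of_nat (Suc n) :: complex) \<subseteq> {c. poly p c = 0}" by auto
  moreover have "infinite (range (\<lambda>n. - of_nat (Suc n) :: complex))"
    by (rule range_inj_infinite) (auto intro: injI)
  ultimately have "p = 0" using poly_roots_finite[of p] finite_subset by blast
  have "coeff p j0 = (\<Sum>t\<in>T'. if t = (i0, j0, m) then x t else 0)"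
    unfolding p_def coeff_sum by (rule sum.cong) (auto simp: T'_def)
  also have "\<dots> = x (i0, j0, m)"
    using t0 finT' by (simp add: sum.delta' T'_def)
  finally show False using t0 \<open>p = 0\<close> by (simp add: T_def)
qed

section \<open>Straightening products into ordered monomials\<close>

lemma sl2_commutator_raise_lower: "sl2_raise * sl2_lower = sl2_lower * sl2_raise + sl2_cartan + sl2_cartan"
  using sl2_commutators(3) cscale_add_left[of 1 1 sl2_cartan] by (simp add: cscale_one)

lemma cartan_mult_lower_power: "sl2_cartan * sl2_lower ^ i = sl2_lower ^ i * sl2_cartan - of_nat i *\<^sub>C sl2_lower ^ i"
proof (induction i)
  case (Suc i)
  have "sl2_cartan * sl2_lower ^ Suc i = (sl2_cartan * sl2_lower ^ i) * sl2_lower"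
    by (simp only: power_Suc2 mult.assoc)
  also have "\<dots> = sl2_lower ^ i * (sl2_cartan * sl2_lower) - of_nat i *\<^sub>C (sl2_lower ^ i * sl2_lower)"
    by (simp only: Suc left_diff_distrib mult_cscale_left mult.assoc)
  also have "\<dots> = sl2_lower ^ Suc i * sl2_cartan - of_nat (Suc i) *\<^sub>C sl2_lower ^ Suc i"
    unfolding sl2_commutators(2)
    by (simp add: power_Suc2 right_diff_distrib mult.assoc cscale_add_left cscale_one del: power_Suc)
  finally show ?case .
qed simp

lemma cartan_mult_raise_power: "sl2_cartan * sl2_raise ^ k = sl2_raise ^ k * sl2_cartan + of_nat k *\<^sub>C sl2_raise ^ k"
proof (induction k)
  case (Suc i)
  have "sl2_cartan * sl2_raise ^ Suc i = (sl2_cartan * sl2_raise ^ i) * sl2_raise"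
    by (simp only: power_Suc2 mult.assoc)
  also have "\<dots> = sl2_raise ^ i * (sl2_cartan * sl2_raise) + of_nat i *\<^sub>C (sl2_raise ^ i * sl2_raise)"
    by (simp only: Suc distrib_right mult_cscale_left mult.assoc)
  also have "\<dots> = sl2_raise ^ Suc i * sl2_cartan + of_nat (Suc i) *\<^sub>C sl2_raise ^ Suc i"
    unfolding sl2_commutators(1)
    by (simp add: power_Suc2 distrib_left mult.assoc cscale_add_left cscale_one del: power_Suc)
  finally show ?case .
qed simp

lemma raise_mult_cartan_power: "sl2_raise * sl2_cartan ^ j = (sl2_cartan - 1) ^ j * sl2_raise"
proof (induction j)
  case (Suc j)
  have "sl2_raise * sl2_cartan = (sl2_cartan - 1) * sl2_raise"
    by (simp add: algebra_simps sl2_commutators(1))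
  hence "sl2_raise * sl2_cartan ^ Suc j = (sl2_cartan - 1) * (sl2_raise * sl2_cartan ^ j)"
    by (simp only: power_Suc mult.assoc[symmetric])
  thus ?case by (simp only: Suc power_Suc mult.assoc)
qed simp

text \<open>Moving e12 across i+1 factors e21 creates 2 e11 at each one. Moving that e11 to the
  right across a remaining factors subtracts a, and summing 2a for a from 0 to i gives the
  correction i(i+1).\<close>

lemma raise_mult_lower_power:
  "sl2_raise * sl2_lower ^ Suc i = sl2_lower ^ Suc i * sl2_raise +
     (of_nat (2 * Suc i) *\<^sub>C (sl2_lower ^ i * sl2_cartan) - of_nat (i * Suc i) *\<^sub>C sl2_lower ^ i)"
proof (induction i)
  case 0
  show ?case using cscale_add_left[of 1 1 sl2_cartan]
    by (simp add: sl2_commutator_raise_lower cscale_one add.assoc)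
next
  case (Suc i)
  let ?f = "sl2_lower ^ Suc i"
  have "sl2_raise * sl2_lower ^ Suc (Suc i) = (sl2_raise * ?f) * sl2_lower"
    by (simp only: power_Suc2 mult.assoc)
  also have "\<dots> = ?f * (sl2_raise * sl2_lower) +
      (of_nat (2 * Suc i) *\<^sub>C (sl2_lower ^ i * (sl2_cartan * sl2_lower)) - of_nat (i * Suc i) *\<^sub>C ?f)"
    unfolding Suc by (simp only: distrib_right left_diff_distrib mult_cscale_left mult.assoc power_Suc2)
  also have "sl2_lower ^ i * (sl2_cartan * sl2_lower) = ?f * sl2_cartan - ?f"
    by (simp only: sl2_commutators(2) right_diff_distrib power_Suc2 mult.assoc)
  also have "?f * (sl2_raise * sl2_lower) = sl2_lower ^ Suc (Suc i) * sl2_raise + 2 *\<^sub>C (?f * sl2_cartan)"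
    by (simp only: sl2_commutators(3) distrib_left power_Suc2[of _ "Suc i"] mult.assoc mult_cscale_right)
  also have "\<dots> + (of_nat (2 * Suc i) *\<^sub>C (?f * sl2_cartan - ?f) - of_nat (i * Suc i) *\<^sub>C ?f) =
      sl2_lower ^ Suc (Suc i) * sl2_raise + ((2 + of_nat (2 * Suc i)) *\<^sub>C (?f * sl2_cartan)
        - (of_nat (2 * Suc i) + of_nat (i * Suc i)) *\<^sub>C ?f)"
    by (simp only: cscale_add_left calg.scale_right_diff_distrib algebra_simps)
  also have "2 + of_nat (2 * Suc i) = (of_nat (2 * Suc (Suc i)) :: complex)" by simp
  also have "of_nat (2 * Suc i) + of_nat (i * Suc i) = (of_nat (Suc i * Suc (Suc i)) :: complex)"
    unfolding of_nat_add[symmetric] by (rule arg_cong[of _ _ of_nat]) simp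
  finally show ?case .
qed

definition pbw_span :: "nat \<Rightarrow> U_sl2 set" where
  "pbw_span N = calg.span (pbw_mono ` {(i, j, k). i + j + k \<le> N})"

lemma pbw_span_base: "i + j + k \<le> N \<Longrightarrow> sl2_lower ^ i * sl2_cartan ^ j * sl2_raise ^ k \<in> pbw_span N"
  unfolding pbw_span_def by (rule calg.span_base, rule image_eqI[of _ _ "(i, j, k)"]) auto

lemma pbw_span_closed:
  "x \<in> pbw_span N \<Longrightarrow> y \<in> pbw_span N \<Longrightarrow> x + y \<in> pbw_span N"
  "x \<in> pbw_span N \<Longrightarrow> y \<in> pbw_span N \<Longrightarrow> x - y \<in> pbw_span N"
  "x \<in> pbw_span N \<Longrightarrow> c *\<^sub>C x \<in> pbw_span N"
  "x \<in> pbw_span N \<Longrightarrow> - x \<in> pbw_span N"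
  unfolding pbw_span_def by (auto intro: calg.span_add calg.span_diff calg.span_scale calg.span_neg)

text \<open>Moving e12 past a power of e11 shifts e11 by -1. The shifted factors are expanded one at
  a time, and \<open>l\<close> collects those already expanded.\<close>

lemma pbw_span_shifted:
  "i + j + l + k \<le> N \<Longrightarrow>
     sl2_lower ^ i * ((sl2_cartan - 1) ^ j * sl2_cartan ^ l) * sl2_raise ^ k \<in> pbw_span N"
proof (induction j arbitrary: l)
  case 0
  thus ?case by (simp add: pbw_span_base)
next
  case (Suc j)
  have "(sl2_cartan - 1) ^ Suc j * sl2_cartan ^ l =
      (sl2_cartan - 1) ^ j * sl2_cartan ^ Suc l - (sl2_cartan - 1) ^ j * sl2_cartan ^ l"
    by (simp add: power_Suc2[of "_ - _"] algebra_simps del: power_Suc) (simp add: mult.assoc power_commutes)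
  moreover have "sl2_lower ^ i * ((sl2_cartan - 1) ^ j * sl2_cartan ^ Suc l) * sl2_raise ^ k \<in> pbw_span N"
    "sl2_lower ^ i * ((sl2_cartan - 1) ^ j * sl2_cartan ^ l) * sl2_raise ^ k \<in> pbw_span N"
    using Suc.prems by (intro Suc.IH; simp)+
  ultimately show ?case by (simp only: left_diff_distrib right_diff_distrib pbw_span_closed)
qed

text \<open>Moving the generator to its ordered place leaves terms of degree at most i+j+k+1, since
  the commutators replace two generators by at most one. The generator e22 is -e11.\<close>

lemma pbw_span_gen_mono:
  assumes "i + j + k \<le> N"
  shows "sl2_e p q * (sl2_lower ^ i * sl2_cartan ^ j * sl2_raise ^ k) \<in> pbw_span (Suc N)" (is "_ * ?m \<in> _")
proof -
  have cartan: "sl2_cartan * ?m \<in> pbw_span (Suc N)"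
  proof -
    have "sl2_cartan * ?m = (sl2_cartan * sl2_lower ^ i) * sl2_cartan ^ j * sl2_raise ^ k"
      by (simp only: mult.assoc)
    also have "\<dots> = sl2_lower ^ i * sl2_cartan ^ Suc j * sl2_raise ^ k - of_nat i *\<^sub>C ?m"
      unfolding cartan_mult_lower_power
      by (simp only: left_diff_distrib mult_cscale_left power_Suc mult.assoc)
    finally show ?thesis using assms by (simp only:) (intro pbw_span_closed pbw_span_base; simp)
  qed
  have lower: "sl2_lower * ?m \<in> pbw_span (Suc N)"
  proof -
    have "sl2_lower * ?m = sl2_lower ^ Suc i * sl2_cartan ^ j * sl2_raise ^ k"
      by (simp only: power_Suc mult.assoc)
    thus ?thesis using assms by (simp only:) (intro pbw_span_base; simp)
  qed
  have lower_raise: "sl2_lower ^ i * (sl2_raise * sl2_cartan ^ j) * sl2_raise ^ k \<in> pbw_span (Suc N)"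
    using pbw_span_shifted[of i j 0 "Suc k" "Suc N"] assms
    by (simp add: raise_mult_cartan_power mult.assoc)
  have raise: "sl2_raise * ?m \<in> pbw_span (Suc N)"
  proof (cases i)
    case 0
    thus ?thesis using lower_raise by (simp add: mult.assoc)
  next
    case (Suc i')
    have "sl2_raise * ?m = (sl2_raise * sl2_lower ^ Suc i') * sl2_cartan ^ j * sl2_raise ^ k"
      by (simp only: mult.assoc Suc)
    also have "\<dots> = sl2_lower ^ i * (sl2_raise * sl2_cartan ^ j) * sl2_raise ^ k +
        (of_nat (2 * Suc i') *\<^sub>C (sl2_lower ^ i' * sl2_cartan ^ Suc j * sl2_raise ^ k)
         - of_nat (i' * Suc i') *\<^sub>C (sl2_lower ^ i' * sl2_cartan ^ j * sl2_raise ^ k))"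
      unfolding raise_mult_lower_power
      by (simp only: distrib_right left_diff_distrib mult_cscale_left power_Suc[of sl2_cartan] mult.assoc Suc)
    finally show ?thesis using assms lower_raise Suc
      by (simp only:) (intro pbw_span_closed pbw_span_base; simp)
  qed
  show ?thesis
  proof (rule num2_cases[of _ p]; rule num2_cases[of _ q])
    show "sl2_e 2 2 * ?m \<in> pbw_span (Suc N)"
      using cartan by (simp only: sl2_e_2_2 mult_minus_left pbw_span_closed)
  qed fact+
qed

lemma pbw_span_gen: "y \<in> pbw_span N \<Longrightarrow> sl2_e p q * y \<in> pbw_span (Suc N)"
proof -
  assume "y \<in> pbw_span N"
  thus ?thesis unfolding pbw_span_def[of N]
  proof (induction rule: calg.span_induct_alt)
    case base
    show ?case by (simp add: pbw_span_def calg.span_zero)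
  next
    case (step c x y)
    then obtain i j k where "i + j + k \<le> N" "x = sl2_lower ^ i * sl2_cartan ^ j * sl2_raise ^ k" by auto
    hence "sl2_e p q * x \<in> pbw_span (Suc N)" using pbw_span_gen_mono by blast
    with step.IH show ?case by (simp only: distrib_left mult_cscale_right pbw_span_closed)
  qed
qed

lemma pbw_mono_weight:
  "sl2_cartan * pbw_mono (i, j, k) - pbw_mono (i, j, k) * sl2_cartan = (of_nat k - of_nat i) *\<^sub>C pbw_mono (i, j, k)"
proof -
  let ?m = "sl2_lower ^ i * sl2_cartan ^ j * sl2_raise ^ k"
  have "sl2_cartan * ?m = (sl2_cartan * sl2_lower ^ i) * sl2_cartan ^ j * sl2_raise ^ k"
    by (simp only: mult.assoc)
  also have "\<dots> = sl2_lower ^ i * (sl2_cartan ^ j * (sl2_cartan * sl2_raise ^ k)) - of_nat i *\<^sub>C ?m"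
    unfolding cartan_mult_lower_power
    by (simp only: left_diff_distrib mult_cscale_left mult.assoc) (simp only: mult.assoc[symmetric] power_commutes)
  also have "\<dots> = ?m * sl2_cartan + of_nat k *\<^sub>C ?m - of_nat i *\<^sub>C ?m"
    unfolding cartan_mult_raise_power by (simp only: distrib_left mult_cscale_right mult.assoc)
  finally show ?thesis by (simp add: calg.scale_left_diff_distrib)
qed

section \<open>The tensor power\<close>

text \<open>Independence of an indexed family allows no repeated vectors, so it yields injectivity
  together with independence of the image sets; cardinalities of index sets thereby become
  dimensions.\<close>

lemma independent_familyD:
  fixes b :: "'i \<Rightarrow> 'a :: complex_algebra_1"
  assumes ind: "\<And>S x t. finite S \<Longrightarrow> (\<Sum>t\<in>S. x t *\<^sub>C b t) = 0 \<Longrightarrow> t \<in> S \<Longrightarrow> x t = 0"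
  shows "inj b" "calg.independent (b ` A)"
proof -
  show inj: "inj b"
  proof (rule injI, rule ccontr)
    fix s t assume st: "b s = b t" "s \<noteq> t"
    have "(\<Sum>u\<in>{s, t}. (if u = s then 1 else - 1) *\<^sub>C b u) = 0"
      using st by simp
    from ind[OF _ this, of s] show False by simp
  qed
  show "calg.independent (b ` A)"
    unfolding calg.independent_explicit_finite_subsets
  proof (intro allI impI ballI)
    fix S u v assume S: "S \<subseteq> b ` A" "finite S" "(\<Sum>v\<in>S. u v *\<^sub>C v) = 0" "v \<in> S"
    then obtain T where T: "S = b ` T" "finite T" using finite_subset_image by metis
    then obtain t where t: "t \<in> T" "v = b t" using S(4) by auto
    have "(\<Sum>t\<in>T. u (b t) *\<^sub>C b t) = 0"
      using S(3) T(1) inj by (simp add: sum.reindex inj_on_subset[OF inj])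
    from ind[OF T(2) this t(1)] show "u v = 0" using t(2) by simp
  qed
qed

text \<open>The values prescribed on an independent set extend to a linear functional.
  \<open>pbw_independent\<close> takes tensor products of these.\<close>

lemma ex_pbw_coordinate:
  "\<exists>l :: U_sl2 \<Rightarrow> complex. (\<forall>x y. l (x + y) = l x + l y) \<and> (\<forall>c x. l (c *\<^sub>C x) = c * l x) \<and>
     (\<forall>s. l (pbw_mono s) = of_bool (s = t))"
proof -
  interpret vector_space_pair "cscale :: complex \<Rightarrow> U_sl2 \<Rightarrow> U_sl2" "(*\<^sub>C) :: complex \<Rightarrow> complex \<Rightarrow> complex" ..
  have ind: "inj pbw_mono" "calg.independent (range pbw_mono)"
    using independent_familyD[of pbw_mono] pbw_mono_independent by blast+
  obtain g where g: "Vector_Spaces.linear (*\<^sub>C) (*\<^sub>C) g"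
      "\<forall>x\<in>range pbw_mono. g x = (of_bool (x = pbw_mono t) :: complex)"
    using linear_independent_extend[of "range pbw_mono" "\<lambda>x. of_bool (x = pbw_mono t)"] ind(2) by blast
  have "g (pbw_mono s) = of_bool (s = t)" for s
    using bspec[OF g(2) rangeI, of s] by (simp only: inj_eq[OF ind(1)])
  thus ?thesis
    by (intro exI[of _ g]) (use g(1) in \<open>auto simp: linear_add linear_scale cscale_complex_def\<close>)
qed

text \<open>The universal property of the tensor power: a product of linear functionals, one per
  factor, is multilinear and so vanishes on \<open>tensor_relations\<close>.\<close>

lemma ex_tensor_functional:
  fixes l :: "'n :: finite \<Rightarrow> 'a :: complex_algebra_1 \<Rightarrow> complex"
  assumes l: "\<And>a x y. l a (x + y) = l a x + l a y" "\<And>a c x. l a (c *\<^sub>C x) = c * l a x"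
  shows "\<exists>\<Lambda> :: ('a, 'n) tensor_power \<Rightarrow> complex. (\<forall>X Y. \<Lambda> (X + Y) = \<Lambda> X + \<Lambda> Y) \<and>
     (\<forall>c X. \<Lambda> (c *\<^sub>C X) = c * \<Lambda> X) \<and> (\<forall>g. \<Lambda> (pure_tensor g) = (\<Prod>a\<in>UNIV. l a (g a)))"
proof -
  define h :: "('n, 'a) tuple \<Rightarrow> complex" where "h = (\<lambda>t. \<Prod>a\<in>UNIV. l a (entry t a))"
  have h: "h (Tuple (f(a := x))) = l a x * (\<Prod>b\<in>UNIV - {a}. l b (f b))" for f a x
    unfolding h_def by (subst prod.remove[of _ a]) (auto intro!: prod.cong)
  have ker: "lin_ext h p = 0" if "p \<in> calg.span tensor_relations" for p
    using that
  proof (induction rule: calg.span_induct_alt)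
    case (step c s p)
    have "lin_ext h s = 0"
      using step.hyps unfolding tensor_relations_def
      by (elim UnE CollectE exE conjE)
        (simp_all add: lin_ext_diff lin_ext_add lin_ext_cscale h l cscale_one cscale_complex_def
          distrib_right)
    with step.IH show ?case by (simp add: lin_ext_add lin_ext_cscale cscale_complex_def)
  qed auto
  \<comment> \<open>Defined on a chosen representative; any two differ by an element of the span of
    the relations, where \<open>ker\<close> gives 0.\<close>
  define \<Lambda> where "\<Lambda> X = lin_ext h (rep_tensor_power X)" for X :: "('a, 'n) tensor_power"
  have abs: "\<Lambda> (abs_tensor_power p) = lin_ext h p" for p
  proof -
    have "rep_tensor_power (abs_tensor_power p) - p \<in> calg.span tensor_relations"
      by (rule Quotient3_rep_abs[OF Quotient3_tensor_power]) (simp add: calg.span_zero)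
    from ker[OF this] show ?thesis by (simp add: \<Lambda>_def lin_ext_diff)
  qed
  have "\<Lambda> (X + Y) = \<Lambda> X + \<Lambda> Y" for X Y
    by (induction X rule: tensor_power.abs_induct, induction Y rule: tensor_power.abs_induct)
      (simp add: plus_tensor_power.abs_eq abs lin_ext_add)
  moreover have "\<Lambda> (c *\<^sub>C X) = c * \<Lambda> X" for c X
    by (induction X rule: tensor_power.abs_induct)
      (simp add: cscale_tensor_power.abs_eq abs lin_ext_cscale cscale_complex_def)
  moreover have "\<Lambda> (pure_tensor g) = (\<Prod>a\<in>UNIV. l a (g a))" for g
    by (simp add: pure_tensor.abs_eq abs h_def cscale_one)
  ultimately show ?thesis by blast
qed

definition pbw :: "('n :: finite \<Rightarrow> nat \<times> nat \<times> nat) \<Rightarrow> (U_sl2, 'n) tensor_power" where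
  "pbw \<mu> = pure_tensor (\<lambda>a. pbw_mono (\<mu> a))"

text \<open>The tensor product of the coordinate functionals at the entries of \<open>\<nu>\<close>
  is 1 on \<open>pbw \<nu>\<close> and 0 on every other product, so it extracts the coefficient of
  \<open>\<nu>\<close>.\<close>

lemma pbw_independent:
  fixes S :: "('n :: finite \<Rightarrow> nat \<times> nat \<times> nat) set"
  assumes fin: "finite S" and sum: "(\<Sum>\<mu>\<in>S. x \<mu> *\<^sub>C pbw \<mu>) = 0" and \<nu>: "\<nu> \<in> S"
  shows "x \<nu> = 0"
proof -
  obtain l :: "nat \<times> nat \<times> nat \<Rightarrow> U_sl2 \<Rightarrow> complex" where
    l: "\<And>t x y. l t (x + y) = l t x + l t y" "\<And>t c x. l t (c *\<^sub>C x) = c * l t x"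
      "\<And>t s. l t (pbw_mono s) = of_bool (s = t)"
    using ex_pbw_coordinate by metis
  obtain \<Lambda> :: "(U_sl2, 'n) tensor_power \<Rightarrow> complex" where
    \<Lambda>: "\<And>X Y. \<Lambda> (X + Y) = \<Lambda> X + \<Lambda> Y" "\<And>c X. \<Lambda> (c *\<^sub>C X) = c * \<Lambda> X"
      "\<And>g. \<Lambda> (pure_tensor g) = (\<Prod>a\<in>UNIV. l (\<nu> a) (g a))"
    using ex_tensor_functional[of "\<lambda>a. l (\<nu> a)"] l by blast
  have pbw: "\<Lambda> (pbw \<mu>) = of_bool (\<mu> = \<nu>)" for \<mu>
    by (auto simp: pbw_def \<Lambda>(3) l(3) fun_eq_iff prod_zero_iff)
  have \<Lambda>0: "\<Lambda> 0 = 0" using \<Lambda>(1)[of 0 0] by simp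
  have "\<Lambda> (\<Sum>\<mu>\<in>S. x \<mu> *\<^sub>C pbw \<mu>) = (\<Sum>\<mu>\<in>S. x \<mu> * \<Lambda> (pbw \<mu>))"
    by (induction S rule: infinite_finite_induct) (simp_all add: \<Lambda> \<Lambda>0)
  also have "\<dots> = x \<nu>" using fin \<nu> by (simp add: pbw of_bool_def if_distrib cong: if_cong)
  finally show ?thesis by (simp add: sum \<Lambda>0)
qed

section \<open>The filtration in terms of ordered monomials\<close>

lemma degree_le_mono: "j \<le> k \<Longrightarrow> degree_le j \<subseteq> degree_le k"
  unfolding degree_le_def by (intro calg.span_mono) auto

lemma degree_le_closed:
  "0 \<in> degree_le k"
  "X \<in> degree_le k \<Longrightarrow> Y \<in> degree_le k \<Longrightarrow> X + Y \<in> degree_le k"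
  "X \<in> degree_le k \<Longrightarrow> Y \<in> degree_le k \<Longrightarrow> X - Y \<in> degree_le k"
  "X \<in> degree_le k \<Longrightarrow> c *\<^sub>C X \<in> degree_le k"
  unfolding degree_le_def
  by (auto intro: calg.span_zero calg.span_add calg.span_diff calg.span_scale)

lemma degree_le_word:
  "length w \<le> k \<Longrightarrow> prod_list (map (\<lambda>(a, i, j). at_factor a (sl2_e i j)) w) \<in> degree_le k"
  unfolding degree_le_def by (intro calg.span_base) blast

lemma degree_le_mult:
  assumes X: "X \<in> degree_le j" and Y: "Y \<in> degree_le k"
  shows "X * Y \<in> degree_le (j + k)"
  using X unfolding degree_le_def[of j]
proof (induction rule: calg.span_induct_alt)
  case base
  show ?case by (simp add: degree_le_closed)
next
  case (step c x z)
  then obtain v where v: "x = prod_list (map (\<lambda>(a, i, j). at_factor a (sl2_e i j)) v)" "length v \<le> j"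
    by blast
  have "x * Y \<in> degree_le (j + k)"
    using Y unfolding degree_le_def[of k]
  proof (induction rule: calg.span_induct_alt)
    case base
    show ?case by (simp add: degree_le_closed)
  next
    case (step c y z)
    then obtain w where w: "y = prod_list (map (\<lambda>(a, i, j). at_factor a (sl2_e i j)) w)" "length w \<le> k"
      by blast
    have "x * y \<in> degree_le (j + k)"
      using degree_le_word[of "v @ w" "j + k"] v w by simp
    with step.IH show ?case by (simp only: distrib_left mult_cscale_right degree_le_closed)
  qed
  with step.IH show ?case by (simp only: distrib_right mult_cscale_left degree_le_closed)
qed

lemma degree_le_1: "1 \<in> degree_le k"
  using degree_le_word[of "[]" k] by simp

lemma degree_le_gen: "at_factor a (sl2_e i j) \<in> degree_le (Suc 0)"
  using degree_le_word[of "[(a, i, j)]" "Suc 0"] by simp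

lemma at_factor_power: "at_factor a (x ^ n) = at_factor a x ^ n"
  by (induction n) (simp_all add: at_factor_1 at_factor_mult)

lemma degree_le_power: "X \<in> degree_le (Suc 0) \<Longrightarrow> X ^ n \<in> degree_le n"
  using degree_le_mult[of X "Suc 0"] by (induction n) (auto simp: degree_le_1)

lemma degree_le_at_factor_mono: "at_factor a (pbw_mono (i, j, k)) \<in> degree_le (i + j + k)"
  unfolding pbw_mono.simps at_factor_mult at_factor_power
  by (intro degree_le_mult degree_le_power degree_le_gen)

lemma at_factor_mult_pure:
  "at_factor a z * pure_tensor g = pure_tensor (g(a := z * g a))"
  "pure_tensor g * at_factor a z = pure_tensor (g(a := g a * z))"
  by (auto simp: at_factor_def pure_tensor_mult fun_eq_iff intro!: arg_cong[where f = pure_tensor])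

lemma pbw_in_degree_le: "pbw \<mu> \<in> degree_le (pbw_degree \<mu>)"
proof -
  \<comment> \<open>The tensor factors are filled one at a time, with 1 in the factors outside
    \<open>A\<close>.\<close>
  have "pure_tensor (\<lambda>a. if a \<in> A then pbw_mono (\<mu> a) else 1) \<in>
      degree_le (\<Sum>a\<in>A. case \<mu> a of (i, j, k) \<Rightarrow> i + j + k)" if "finite A" for A
    using that
  proof (induction A rule: finite_induct)
    case empty
    have "pure_tensor (\<lambda>a :: 'a. 1 :: U_sl2) = at_factor a 1" for a
      unfolding at_factor_def by (rule arg_cong[of _ _ pure_tensor]) auto
    thus ?case by (simp add: at_factor_1 degree_le_1)
  next
    case (insert a A)
    have "pure_tensor (\<lambda>b. if b \<in> insert a A then pbw_mono (\<mu> b) else 1) =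
        at_factor a (pbw_mono (\<mu> a)) * pure_tensor (\<lambda>b. if b \<in> A then pbw_mono (\<mu> b) else 1)"
      unfolding at_factor_mult_pure using insert.hyps
      by (auto intro!: arg_cong[of _ _ pure_tensor])
    moreover have "at_factor a (pbw_mono (\<mu> a)) \<in> degree_le (case \<mu> a of (i, j, k) \<Rightarrow> i + j + k)"
      by (cases "\<mu> a") (simp only: prod.case degree_le_at_factor_mono)
    ultimately show ?case using insert by (simp add: degree_le_mult)
  qed
  from this[of UNIV] show ?thesis by (simp add: pbw_def pbw_degree_def)
qed

lemma pbw_degree_upd:
  "pbw_degree (\<mu>(a := (i, j, k))) + (case \<mu> a of (i, j, k) \<Rightarrow> i + j + k) = pbw_degree \<mu> + (i + j + k)"
proof -
  have "(\<Sum>b\<in>UNIV - {a}. case (\<mu>(a := (i, j, k))) b of (i, j, k) \<Rightarrow> i + j + k) =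
      (\<Sum>b\<in>UNIV - {a}. case \<mu> b of (i, j, k) \<Rightarrow> i + j + k)"
    by (intro sum.cong) auto
  thus ?thesis unfolding pbw_degree_def
    by (subst (1 2) sum.remove[of UNIV a]) simp_all
qed

text \<open>Only the entry at \<open>a\<close> changes. There \<open>pbw_span_gen\<close> rewrites
  the product with local degree at most one larger, and multilinearity expands the pure tensor
  accordingly.\<close>

lemma span_pbw_gen:
  assumes "Y \<in> calg.span (pbw ` {\<mu>. pbw_degree \<mu> \<le> N})"
  shows "at_factor a (sl2_e p q) * Y \<in> calg.span (pbw ` {\<mu>. pbw_degree \<mu> \<le> Suc N})"
  using assms
proof (induction rule: calg.span_induct_alt)
  case base
  show ?case by (simp add: calg.span_zero)
next
  case (step c x Y)
  then obtain \<mu> where \<mu>: "x = pbw \<mu>" "pbw_degree \<mu> \<le> N" by auto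
  define M where "M = (case \<mu> a of (i, j, k) \<Rightarrow> i + j + k)"
  have *: "pure_tensor ((\<lambda>b. pbw_mono (\<mu> b))(a := y)) \<in> calg.span (pbw ` {\<mu>. pbw_degree \<mu> \<le> Suc N})"
    if "y \<in> pbw_span (Suc M)" for y
    using that unfolding pbw_span_def
  proof (induction rule: calg.span_induct_alt)
    case base
    have "pure_tensor ((\<lambda>b. pbw_mono (\<mu> b))(a := 0)) = 0"
      using pure_tensor_cscale[of "\<lambda>b. pbw_mono (\<mu> b)" a 0 0] by simp
    thus ?case by (simp only: calg.span_zero)
  next
    case (step d z y)
    then obtain i j k where ijk: "i + j + k \<le> Suc M" "z = pbw_mono (i, j, k)" by auto
    have "pure_tensor ((\<lambda>b. pbw_mono (\<mu> b))(a := z)) = pbw (\<mu>(a := (i, j, k)))"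
      unfolding pbw_def ijk(2) by (rule arg_cong[of _ _ pure_tensor]) (simp add: fun_eq_iff)
    moreover have "pbw_degree (\<mu>(a := (i, j, k))) \<le> Suc N"
      using pbw_degree_upd[of \<mu> a i j k] \<mu>(2) ijk(1) unfolding M_def by linarith
    ultimately have "pure_tensor ((\<lambda>b. pbw_mono (\<mu> b))(a := z)) \<in> calg.span (pbw ` {\<mu>. pbw_degree \<mu> \<le> Suc N})"
      by (auto intro: calg.span_base)
    thus ?case unfolding pure_tensor_add pure_tensor_cscale
      by (intro calg.span_add calg.span_scale step.IH)
  qed
  have "at_factor a (sl2_e p q) * pbw \<mu> = pure_tensor ((\<lambda>b. pbw_mono (\<mu> b))(a := sl2_e p q * pbw_mono (\<mu> a)))"
    unfolding pbw_def at_factor_mult_pure ..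
  moreover have "pbw_mono (\<mu> a) \<in> pbw_span M"
    unfolding pbw_span_def M_def by (cases "\<mu> a") (intro calg.span_base imageI, simp)
  ultimately have "at_factor a (sl2_e p q) * x \<in> calg.span (pbw ` {\<mu>. pbw_degree \<mu> \<le> Suc N})"
    using *[OF pbw_span_gen] \<mu>(1) by simp
  with step.IH show ?case
    unfolding distrib_left mult_cscale_right by (intro calg.span_add calg.span_scale)
qed

text \<open>This replaces the spanning words by a basis adapted to the filtration. Each letter
  multiplied on the left raises the degree by at most one, so a word lies in the span for its
  length.\<close>

lemma degree_le_eq_span_pbw: "(degree_le N :: (U_sl2, 'n :: finite) tensor_power set) = calg.span (pbw ` {\<mu>. pbw_degree \<mu> \<le> N})"
proof (rule antisym)
  have word: "prod_list (map (\<lambda>(a, i, j). at_factor a (sl2_e i j)) w) \<in>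
      calg.span (pbw ` {\<mu>. pbw_degree \<mu> \<le> length w})" for w :: "('n \<times> 2 \<times> 2) list"
  proof (induction w)
    case Nil
    \<comment> \<open>\<open>undefined\<close> is an arbitrary tensor factor: the unit placed in any
      factor is the unit of the tensor power.\<close>
    have "(1 :: (U_sl2, 'n) tensor_power) = at_factor undefined 1" by (simp add: at_factor_1)
    also have "\<dots> = pbw (\<lambda>_. (0, 0, 0))"
      unfolding at_factor_def pbw_def by (rule arg_cong[of _ _ pure_tensor]) auto
    finally have "(1 :: (U_sl2, 'n) tensor_power) = pbw (\<lambda>_. (0, 0, 0))" .
    moreover have "pbw_degree (\<lambda>_ :: 'n. (0, 0, 0)) = 0" by (simp add: pbw_degree_def)
    ultimately show ?case by (auto intro!: calg.span_base)
  next
    case (Cons x w)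
    thus ?case using span_pbw_gen[OF Cons] by (cases x) simp
  qed
  show "degree_le N \<subseteq> calg.span (pbw ` {\<mu> :: 'n \<Rightarrow> _. pbw_degree \<mu> \<le> N})"
  proof -
    have "x \<in> calg.span (pbw ` {\<mu>. pbw_degree \<mu> \<le> N})"
      if "x \<in> {prod_list (map (\<lambda>(a, i, j). at_factor a (sl2_e i j)) w) | w. length w \<le> N}"
      for x :: "(U_sl2, 'n) tensor_power"
    proof -
      from that obtain w where w: "x = prod_list (map (\<lambda>(a, i, j). at_factor a (sl2_e i j)) w)" "length w \<le> N"
        by blast
      have "calg.span (pbw ` {\<mu> :: 'n \<Rightarrow> _. pbw_degree \<mu> \<le> length w}) \<subseteq>
          calg.span (pbw ` {\<mu>. pbw_degree \<mu> \<le> N})"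
        using w(2) by (intro calg.span_mono) auto
      with word[of w] w(1) show "x \<in> calg.span (pbw ` {\<mu>. pbw_degree \<mu> \<le> N})" by blast
    qed
    thus ?thesis unfolding degree_le_def
      by (intro calg.span_minimal[OF _ calg.subspace_span] subsetI)
  qed
  show "calg.span (pbw ` {\<mu> :: 'n \<Rightarrow> _. pbw_degree \<mu> \<le> N}) \<subseteq> degree_le N"
  proof (rule calg.span_minimal)
    show "pbw ` {\<mu> :: 'n \<Rightarrow> _. pbw_degree \<mu> \<le> N} \<subseteq> degree_le N"
      using pbw_in_degree_le degree_le_mono by blast
    show "calg.subspace (degree_le N :: (U_sl2, 'n) tensor_power set)" unfolding degree_le_def by (rule calg.subspace_span)
  qed
qed

section \<open>The adjoint action through the diagonal embedding\<close>

definition diag_ad :: "U_sl2 \<Rightarrow> (U_sl2, 'n :: finite) tensor_power \<Rightarrow> (U_sl2, 'n) tensor_power" where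
  "diag_ad g X = diag_emb g * X - X * diag_emb g"

text \<open>The summand of the diagonal e11 in factor \<open>a\<close> acts on the entry at
  \<open>a\<close> alone, with eigenvalue k - i by \<open>pbw_mono_weight\<close>. The eigenvalues
  add up over the factors.\<close>

lemma diag_ad_pbw: "diag_ad sl2_cartan (pbw \<mu>) = of_int (pbw_weight \<mu>) *\<^sub>C pbw \<mu>"
proof -
  let ?g = "\<lambda>b. pbw_mono (\<mu> b)"
  have "at_factor a sl2_cartan * pbw \<mu> - pbw \<mu> * at_factor a sl2_cartan =
      of_int (case \<mu> a of (i, j, k) \<Rightarrow> int k - int i) *\<^sub>C pbw \<mu>" for a
  proof -
    have diff: "pure_tensor (?g(a := x)) - pure_tensor (?g(a := y)) = pure_tensor (?g(a := x - y))" for x y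
      using pure_tensor_add[of ?g a "x - y" y] by simp
    have "at_factor a sl2_cartan * pbw \<mu> - pbw \<mu> * at_factor a sl2_cartan =
        pure_tensor (?g(a := sl2_cartan * pbw_mono (\<mu> a) - pbw_mono (\<mu> a) * sl2_cartan))"
      unfolding pbw_def at_factor_mult_pure diff ..
    also have "sl2_cartan * pbw_mono (\<mu> a) - pbw_mono (\<mu> a) * sl2_cartan =
        of_int (case \<mu> a of (i, j, k) \<Rightarrow> int k - int i) *\<^sub>C pbw_mono (\<mu> a)"
      by (cases "\<mu> a") (simp only: pbw_mono_weight prod.case of_int_diff of_int_of_nat_eq)
    finally show ?thesis unfolding pure_tensor_cscale by (simp add: pbw_def fun_upd_idem)
  qed
  thus ?thesis
    by (simp add: diag_ad_def diag_emb_sl2_e sum_distrib_left sum_distrib_right pbw_weight_def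
        calg.scale_sum_left flip: sum_subtractf)
qed

lemma diag_ad_linear: "Vector_Spaces.linear (*\<^sub>C) (*\<^sub>C) (diag_ad g)"
proof
  fix X Y c
  show "diag_ad g (X + Y) = diag_ad g X + diag_ad g Y" by (simp add: diag_ad_def algebra_simps)
  show "diag_ad g (c *\<^sub>C X) = c *\<^sub>C diag_ad g X"
    by (simp add: diag_ad_def mult_cscale_left mult_cscale_right calg.scale_right_diff_distrib)
qed

lemma diag_ad_commutator:
  "diag_ad g (diag_ad g' X) = diag_ad g' (diag_ad g X) + diag_ad (g * g' - g' * g) X"
proof -
  have "diag_emb (g * g' - g' * g) + diag_emb (g' * g) = (diag_emb (g * g') :: (U_sl2, 'a) tensor_power)"
    unfolding diag_emb_hom(3)[symmetric] by simp
  hence comm: "diag_emb (g * g' - g' * g) = (diag_emb g * diag_emb g' - diag_emb g' * diag_emb g :: (U_sl2, 'a) tensor_power)"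
    by (simp add: diag_emb_hom(2) eq_diff_eq)
  show ?thesis unfolding diag_ad_def comm by (simp add: algebra_simps)
qed

text \<open>A commutator with a generator could a priori raise the degree by one. It does not,
  because it is a derivation sending each generator to a combination of generators in the same
  factor.\<close>

lemma diag_ad_degree_le:
  assumes "X \<in> degree_le k"
  shows "diag_ad (sl2_e i j) X \<in> degree_le k"
proof -
  interpret D: Vector_Spaces.linear "(*\<^sub>C)" "(*\<^sub>C)" "diag_ad (sl2_e i j) :: (U_sl2, 'a) tensor_power \<Rightarrow> _"
    by (rule diag_ad_linear)
  have of_bool: "at_factor a (of_bool b * sl2_e p q) \<in> degree_le (Suc 0)" for a :: 'a and b p q
    by (cases b) (simp_all add: degree_le_closed degree_le_gen)
  have gen: "diag_ad (sl2_e i j) (at_factor a (sl2_e p q)) \<in> degree_le (Suc 0)" for a :: 'a and p q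
  proof -
    have "diag_ad (sl2_e i j) (at_factor a (sl2_e p q)) =
        (\<Sum>b\<in>UNIV. at_factor b (sl2_e i j) * at_factor a (sl2_e p q) - at_factor a (sl2_e p q) * at_factor b (sl2_e i j))"
      by (simp add: diag_ad_def diag_emb_sl2_e sum_distrib_left sum_distrib_right sum_subtractf)
    also have "\<dots> = (\<Sum>b\<in>UNIV. if b = a then at_factor a (sl2_e i j * sl2_e p q - sl2_e p q * sl2_e i j) else 0)"
      by (intro sum.cong refl) (auto simp: at_factor_commute at_factor_diff at_factor_mult)
    also have "\<dots> = at_factor a (of_bool (j = p) * sl2_e i q - of_bool (q = i) * sl2_e p j)"
      by (simp add: sl2_e_commutator)
    also have "\<dots> \<in> degree_le (Suc 0)"
      unfolding at_factor_diff by (intro degree_le_closed(3) of_bool)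
    finally show ?thesis .
  qed
  have word: "diag_ad (sl2_e i j) (prod_list (map (\<lambda>(a, i, j). at_factor a (sl2_e i j)) w)) \<in> degree_le (length w)"
    for w :: "('a \<times> 2 \<times> 2) list"
  proof (induction w)
    case Nil
    show ?case by (simp add: diag_ad_def degree_le_closed)
  next
    case (Cons x w)
    obtain a p q where x: "x = (a, p, q)" by (cases x)
    let ?W = "prod_list (map (\<lambda>(a, i, j). at_factor a (sl2_e i j)) w) :: (U_sl2, 'a) tensor_power"
    \<comment> \<open>The Leibniz rule; it preserves the length bound since either the letter or the
      rest of the word is differentiated.\<close>
    have "diag_ad (sl2_e i j) (at_factor a (sl2_e p q) * ?W) =
        diag_ad (sl2_e i j) (at_factor a (sl2_e p q)) * ?W + at_factor a (sl2_e p q) * diag_ad (sl2_e i j) ?W"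
      by (simp add: diag_ad_def algebra_simps)
    also have "\<dots> \<in> degree_le (Suc 0 + length w)"
      by (intro degree_le_closed degree_le_mult gen degree_le_gen Cons degree_le_word order_refl)
    finally show ?case by (simp add: x)
  qed
  show ?thesis using assms unfolding degree_le_def[of k]
  proof (induction rule: calg.span_induct_alt)
    case base
    show ?case by (simp add: D.zero calg.span_zero)
  next
    case (step c x Y)
    then obtain w where "x = prod_list (map (\<lambda>(a, i, j). at_factor a (sl2_e i j)) w)" "length w \<le> k"
      by blast
    hence "diag_ad (sl2_e i j) x \<in> degree_le k" using word degree_le_mono by blast
    with step.IH show ?case unfolding degree_le_def[symmetric] by (simp add: D.add D.scale degree_le_closed)
  qed
qed

text \<open>Commuting with the images of the generators extends to all of the diagonal image, since
  \<open>diag_emb\<close> is an algebra map; e22 is covered by the trace relation.\<close>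

lemma centralizer_sl2_iff:
  "X \<in> centralizer_sl2 \<longleftrightarrow>
     diag_ad sl2_raise X = 0 \<and> diag_ad sl2_lower X = 0 \<and> diag_ad sl2_cartan X = 0" (is "_ \<longleftrightarrow> ?R")
proof
  assume ?R
  hence gen: "diag_emb (sl2_e i j) * X = X * diag_emb (sl2_e i j)" for i j
  proof (rule_tac num2_cases[of _ i]; rule_tac num2_cases[of _ j])
    assume R: ?R
    have "diag_emb (sl2_e 1 1) + diag_emb (sl2_e 2 2) = (diag_emb 0 :: (U_sl2, 'a) tensor_power)"
      by (simp add: sl2_e_trace flip: diag_emb_hom(3))
    also have "\<dots> = 0" using diag_emb_hom(3)[of 0 0] by simp
    finally have "diag_emb (sl2_e 2 2) = - (diag_emb sl2_cartan :: (U_sl2, 'a) tensor_power)"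
      by (simp add: eq_neg_iff_add_eq_0 add.commute)
    thus "diag_emb (sl2_e 2 2) * X = X * diag_emb (sl2_e 2 2)" using R by (simp add: diag_ad_def)
  qed (simp_all add: diag_ad_def)
  have "diag_emb g * X = X * diag_emb g" for g
  proof (induction g rule: U_sl2_induct)
    case (mult i j x)
    have "diag_emb (sl2_e i j) * diag_emb x * X = diag_emb (sl2_e i j) * X * diag_emb x"
      by (simp only: mult.assoc mult.IH)
    thus ?case by (simp only: diag_emb_hom gen mult.assoc)
  qed (simp_all add: diag_emb_hom mult_cscale_left mult_cscale_right algebra_simps)
  thus "X \<in> centralizer_sl2" by (simp add: centralizer_sl2_def)
qed (auto simp: centralizer_sl2_def diag_ad_def)

section \<open>The centralizer\<close>

lemma calg_dim_0: "calg.dim {0} = 0"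
  using calg.dim_unique[of "{}" "{0}" 0] calg.independent_empty by simp

lemma calg_dim_mono:
  fixes V W :: "'a :: complex_algebra_1 set"
  assumes V: "calg.subspace V" and W: "calg.subspace W" and WV: "W \<subseteq> V"
    and fin: "finite T" "V \<subseteq> calg.span T"
  shows "calg.dim W \<le> calg.dim V"
proof -
  obtain A B where AB: "finite (A \<union> B)" "calg.independent (A \<union> B)"
    "calg.span A = W" "calg.span (A \<union> B) = V"
    using calg_basis_extend[OF V W WV fin] by metis
  have "calg.independent A" using AB(2) calg.independent_mono by blast
  hence "calg.dim W = card A" using AB(3) calg.dim_span_eq_card_independent by blast
  moreover have "calg.dim V = card (A \<union> B)" using AB(2,4) calg.dim_span_eq_card_independent by blast
  ultimately show ?thesis using AB(1) by (simp add: card_mono)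
qed

lemma finite_pbw_degree: "finite {\<mu> :: 'n :: finite \<Rightarrow> _. pbw_degree \<mu> \<le> k}"
proof (rule finite_subset)
  show "finite (PiE (UNIV :: 'n set) (\<lambda>_. {..k} \<times> {..k} \<times> {..k}))" by (intro finite_PiE) auto
  show "{\<mu> :: 'n \<Rightarrow> _. pbw_degree \<mu> \<le> k} \<subseteq> PiE UNIV (\<lambda>_. {..k} \<times> {..k} \<times> {..k})"
  proof (intro subsetI PiE_I)
    fix \<mu> :: "'n \<Rightarrow> nat \<times> nat \<times> nat" and a
    assume "\<mu> \<in> {\<mu>. pbw_degree \<mu> \<le> k}"
    moreover have "(case \<mu> a of (i, j, k) \<Rightarrow> i + j + k) \<le> pbw_degree \<mu>"
      unfolding pbw_degree_def by (rule member_le_sum) auto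
    ultimately show "\<mu> a \<in> {..k} \<times> {..k} \<times> {..k}" by (cases "\<mu> a") auto
  qed auto
qed

lemma abs_pbw_weight_le: "\<bar>pbw_weight \<mu>\<bar> \<le> int (pbw_degree \<mu>)"
proof -
  have "\<bar>pbw_weight \<mu>\<bar> \<le> (\<Sum>a\<in>UNIV. \<bar>case \<mu> a of (i, j, k) \<Rightarrow> int k - int i\<bar>)"
    unfolding pbw_weight_def by (rule sum_abs)
  also have "\<dots> \<le> (\<Sum>a\<in>UNIV. int (case \<mu> a of (i, j, k) \<Rightarrow> i + j + k))"
    by (intro sum_mono) (auto split: prod.split)
  finally show ?thesis by (simp add: pbw_degree_def)
qed

section \<open>Weight spaces of the filtration steps\<close>

definition weight_space :: "nat \<Rightarrow> int \<Rightarrow> (U_sl2, 'n :: finite) tensor_power set" where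
  "weight_space k w = calg.span (pbw ` {\<mu>. pbw_degree \<mu> \<le> k \<and> pbw_weight \<mu> = w})"

lemma subspace_weight_space: "calg.subspace (weight_space k w)"
  unfolding weight_space_def by (rule calg.subspace_span)

lemma inj_pbw: "inj pbw"
  by (rule independent_familyD(1)[of pbw]) (rule pbw_independent)

lemma independent_pbw: "calg.independent (pbw ` A)"
  by (rule independent_familyD(2)[of pbw]) (rule pbw_independent)

lemma dim_weight_space:
  "calg.dim (weight_space k w :: (U_sl2, 'n :: finite) tensor_power set) =
     card {\<mu> :: 'n \<Rightarrow> _. pbw_degree \<mu> \<le> k \<and> pbw_weight \<mu> = w}"
  unfolding weight_space_def calg.dim_span_eq_card_independent[OF independent_pbw]
  by (rule card_image[OF inj_on_subset[OF inj_pbw]]) simp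

text \<open>Passes from the spanning monomials to the eigenvalue equation. For the converse, expand
  in the monomial basis: the diagonal e11 acts diagonally, so coefficients at other weights must
  vanish.\<close>

lemma weight_space_iff:
  fixes X :: "(U_sl2, 'n :: finite) tensor_power"
  shows "X \<in> weight_space k w \<longleftrightarrow> X \<in> degree_le k \<and> diag_ad sl2_cartan X = of_int w *\<^sub>C X"
proof -
  interpret H: Vector_Spaces.linear "(*\<^sub>C)" "(*\<^sub>C)" "diag_ad sl2_cartan :: (U_sl2, 'n) tensor_power \<Rightarrow> _"
    by (rule diag_ad_linear)
  show ?thesis
  proof
    assume X: "X \<in> weight_space k w"
    have "weight_space k w \<subseteq> (degree_le k :: (U_sl2, 'n) tensor_power set)"
      unfolding weight_space_def degree_le_eq_span_pbw by (intro calg.span_mono image_mono) auto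
    moreover have "diag_ad sl2_cartan X = of_int w *\<^sub>C X"
      using X unfolding weight_space_def
    proof (induction rule: calg.span_induct_alt)
      case base
      show ?case by (simp add: H.zero)
    next
      case (step c x y)
      hence "diag_ad sl2_cartan x = of_int w *\<^sub>C x" using diag_ad_pbw by auto
      with step.IH show ?case
        by (simp add: H.add H.scale cscale_add_right cscale_cscale mult.commute)
    qed
    ultimately show "X \<in> degree_le k \<and> diag_ad sl2_cartan X = of_int w *\<^sub>C X" using X by blast
  next
    assume X: "X \<in> degree_le k \<and> diag_ad sl2_cartan X = of_int w *\<^sub>C X"
    define D where "D = {\<mu> :: 'n \<Rightarrow> _. pbw_degree \<mu> \<le> k}"
    have fin: "finite D" unfolding D_def by (rule finite_pbw_degree)
    have "X \<in> calg.span (pbw ` D)" using X by (simp add: degree_le_eq_span_pbw D_def)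
    then obtain u where "X = (\<Sum>v\<in>pbw ` D. u v *\<^sub>C v)"
      using calg.span_finite[of "pbw ` D"] fin by auto
    also have "\<dots> = (\<Sum>\<mu>\<in>D. u (pbw \<mu>) *\<^sub>C pbw \<mu>)"
      by (subst sum.reindex[OF inj_on_subset[OF inj_pbw]]) auto
    finally have Xu: "X = (\<Sum>\<mu>\<in>D. u (pbw \<mu>) *\<^sub>C pbw \<mu>)" .
    \<comment> \<open>This is the action of e11 minus the scalar \<open>w\<close>, applied to the
      expansion of \<open>X\<close>.\<close>
    have "(\<Sum>\<mu>\<in>D. (u (pbw \<mu>) * (of_int (pbw_weight \<mu>) - of_int w)) *\<^sub>C pbw \<mu>) =
        (\<Sum>\<mu>\<in>D. u (pbw \<mu>) *\<^sub>C (of_int (pbw_weight \<mu>) *\<^sub>C pbw \<mu>)) - of_int w *\<^sub>C X"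
      by (simp add: Xu calg.scale_sum_right cscale_cscale calg.scale_left_diff_distrib
          sum_subtractf[symmetric] algebra_simps)
    also have "(\<Sum>\<mu>\<in>D. u (pbw \<mu>) *\<^sub>C (of_int (pbw_weight \<mu>) *\<^sub>C pbw \<mu>)) = diag_ad sl2_cartan X"
      by (simp add: Xu H.sum H.scale diag_ad_pbw)
    finally have "(\<Sum>\<mu>\<in>D. (u (pbw \<mu>) * (of_int (pbw_weight \<mu>) - of_int w)) *\<^sub>C pbw \<mu>) = 0"
      using X by simp
    hence *: "u (pbw \<mu>) = 0" if "\<mu> \<in> D" "pbw_weight \<mu> \<noteq> w" for \<mu>
      using pbw_independent[OF fin, of "\<lambda>\<mu>. u (pbw \<mu>) * (of_int (pbw_weight \<mu>) - of_int w)" \<mu>] that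
      by auto
    have "u (pbw \<mu>) *\<^sub>C pbw \<mu> \<in> weight_space k w" if "\<mu> \<in> D" for \<mu>
    proof (cases "pbw_weight \<mu> = w")
      case True
      thus ?thesis using that unfolding weight_space_def D_def
        by (intro calg.span_scale calg.span_base) auto
    next
      case False
      thus ?thesis using *[OF that] calg.subspace_0[OF subspace_weight_space] by simp
    qed
    thus "X \<in> weight_space k w" unfolding Xu by (intro calg.subspace_sum[OF subspace_weight_space])
  qed
qed

lemma weight_space_trivial:
  fixes X :: "(U_sl2, 'n :: finite) tensor_power"
  assumes "X \<in> weight_space k w" "\<bar>w\<bar> > int k"
  shows "X = 0"
proof -
  have empty: "{\<mu> :: 'n \<Rightarrow> _. pbw_degree \<mu> \<le> k \<and> pbw_weight \<mu> = w} = {}"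
  proof (intro equals0I, elim CollectE conjE)
    fix \<mu> :: "'n \<Rightarrow> nat \<times> nat \<times> nat"
    assume "pbw_degree \<mu> \<le> k" "pbw_weight \<mu> = w"
    with abs_pbw_weight_le[of \<mu>] assms(2) show False by simp
  qed
  show ?thesis using assms(1) unfolding weight_space_def empty by simp
qed

lemma diag_ad_cscale: "diag_ad (c *\<^sub>C g) X = c *\<^sub>C diag_ad g X"
  by (simp add: diag_ad_def diag_emb_hom mult_cscale_left mult_cscale_right calg.scale_right_diff_distrib)

lemma diag_ad_relations:
  "diag_ad sl2_cartan (diag_ad sl2_raise X) = diag_ad sl2_raise (diag_ad sl2_cartan X) + diag_ad sl2_raise X"
  "diag_ad sl2_cartan (diag_ad sl2_lower X) = diag_ad sl2_lower (diag_ad sl2_cartan X) - diag_ad sl2_lower X"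
  "diag_ad sl2_raise (diag_ad sl2_lower X) =
     diag_ad sl2_lower (diag_ad sl2_raise X) + 2 *\<^sub>C diag_ad sl2_cartan X"
proof -
  have "sl2_cartan * sl2_lower - sl2_lower * sl2_cartan = (- 1) *\<^sub>C sl2_lower"
    by (simp add: sl2_commutators cscale_one calg.scale_minus_left)
  hence "diag_ad (sl2_cartan * sl2_lower - sl2_lower * sl2_cartan) X = (- 1) *\<^sub>C diag_ad sl2_lower X"
    by (simp only: diag_ad_cscale)
  thus "diag_ad sl2_cartan (diag_ad sl2_lower X) = diag_ad sl2_lower (diag_ad sl2_cartan X) - diag_ad sl2_lower X"
    using diag_ad_commutator[of sl2_cartan sl2_lower X] by (simp add: cscale_one calg.scale_minus_left)
qed (subst diag_ad_commutator, simp add: sl2_commutators diag_ad_cscale)+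

lemma weight_space_raise:
  assumes "X \<in> weight_space k w"
  shows "diag_ad sl2_raise X \<in> weight_space k (w + 1)"
proof -
  interpret E: Vector_Spaces.linear "(*\<^sub>C)" "(*\<^sub>C)" "diag_ad sl2_raise :: (U_sl2, 'a) tensor_power \<Rightarrow> _"
    by (rule diag_ad_linear)
  show ?thesis using assms
    by (auto simp: weight_space_iff diag_ad_degree_le diag_ad_relations E.scale cscale_add_left cscale_one)
qed

lemma weight_space_lower:
  assumes "X \<in> weight_space k w"
  shows "diag_ad sl2_lower X \<in> weight_space k (w - 1)"
proof -
  interpret F: Vector_Spaces.linear "(*\<^sub>C)" "(*\<^sub>C)" "diag_ad sl2_lower :: (U_sl2, 'a) tensor_power \<Rightarrow> _"
    by (rule diag_ad_linear)
  show ?thesis using assms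
    by (auto simp: weight_space_iff diag_ad_degree_le diag_ad_relations F.scale
        calg.scale_left_diff_distrib cscale_one)
qed

text \<open>Each application raises the weight by one within the same filtration step, where weights
  are bounded by \<open>k\<close> in absolute value.\<close>

lemma raise_nilpotent: "X \<in> weight_space k w \<Longrightarrow> \<exists>N. (diag_ad sl2_raise ^^ N) X = 0"
proof -
  assume X: "X \<in> weight_space k w"
  have "(diag_ad sl2_raise ^^ j) X \<in> weight_space k (w + int j)" for j
  proof (induction j)
    case (Suc j)
    thus ?case using weight_space_raise[OF Suc] by (simp add: add_ac)
  qed (use X in simp)
  \<comment> \<open>This exponent brings the weight to at least k+1 whatever the sign of
    \<open>w\<close>.\<close>
  from weight_space_trivial[OF this[of "nat (int k + 1 + \<bar>w\<bar>)"]]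
  have "(diag_ad sl2_raise ^^ nat (int k + 1 + \<bar>w\<bar>)) X = 0" by simp
  thus ?thesis ..
qed

lemma lower_nilpotent: "X \<in> weight_space k w \<Longrightarrow> \<exists>N. (diag_ad sl2_lower ^^ N) X = 0"
proof -
  assume X: "X \<in> weight_space k w"
  have "(diag_ad sl2_lower ^^ j) X \<in> weight_space k (w - int j)" for j
  proof (induction j)
    case (Suc j)
    thus ?case using weight_space_lower[OF Suc] by (simp add: algebra_simps)
  qed (use X in simp)
  from weight_space_trivial[OF this[of "nat (int k + 1 + \<bar>w\<bar>)"]]
  have "(diag_ad sl2_lower ^^ nat (int k + 1 + \<bar>w\<bar>)) X = 0" by simp
  thus ?thesis ..
qed

section \<open>Dimensions of the graded pieces of the centralizer\<close>

text \<open>A vector of weight 0 killed by raising is also killed by lowering, by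
  \<open>lowering_kills_invariant\<close> and nilpotency of lowering. Being invariant thus becomes a
  kernel condition for one linear map.\<close>

lemma centralizer_degree_le_eq:
  "centralizer_sl2 \<inter> degree_le k = weight_space k 0 \<inter> {X. diag_ad sl2_raise X = 0}"
proof (intro equalityI subsetI)
  fix X :: "(U_sl2, 'a) tensor_power"
  assume X: "X \<in> weight_space k 0 \<inter> {X. diag_ad sl2_raise X = 0}"
  hence HX: "diag_ad sl2_cartan X = 0" by (simp add: weight_space_iff)
  obtain N where N: "(diag_ad sl2_lower ^^ N) X = 0" using lower_nilpotent X by blast
  have "diag_ad sl2_lower X = 0"
    by (rule lowering_kills_invariant[OF diag_ad_linear diag_ad_linear diag_ad_linear
          diag_ad_relations(3) diag_ad_relations(2) HX _ N]) (use X in simp)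
  thus "X \<in> centralizer_sl2 \<inter> degree_le k"
    using X HX by (simp add: centralizer_sl2_iff weight_space_iff)
qed (auto simp: centralizer_sl2_iff weight_space_iff)

text \<open>Write V_w for the weight spaces. Raising after lowering is injective on V_1, and its
  image lies in E V_0, which lies in V_1. Hence dim E V_0 = dim V_1, and rank-nullity for raising on
  V_0 gives the dimension of its kernel.\<close>

lemma dim_centralizer_degree_le:
  "calg.dim (centralizer_sl2 \<inter> degree_le k :: (U_sl2, 'n :: finite) tensor_power set) +
     card {\<mu> :: 'n \<Rightarrow> _. pbw_degree \<mu> \<le> k \<and> pbw_weight \<mu> = 1} =
   card {\<mu> :: 'n \<Rightarrow> _. pbw_degree \<mu> \<le> k \<and> pbw_weight \<mu> = 0}"
proof -
  let ?V = "weight_space k :: int \<Rightarrow> (U_sl2, 'n) tensor_power set"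
  let ?E = "diag_ad sl2_raise :: (U_sl2, 'n) tensor_power \<Rightarrow> _"
  let ?F = "diag_ad sl2_lower :: (U_sl2, 'n) tensor_power \<Rightarrow> _"
  define B where "B w = pbw ` {\<mu> :: 'n \<Rightarrow> _. pbw_degree \<mu> \<le> k \<and> pbw_weight \<mu> = w}" for w
  have finB: "finite (B w)" for w
    unfolding B_def by (rule finite_imageI, rule finite_subset[OF _ finite_pbw_degree[of k]]) auto
  have VB: "?V w \<subseteq> calg.span (B w)" for w unfolding B_def weight_space_def ..
  interpret E: Vector_Spaces.linear "(*\<^sub>C)" "(*\<^sub>C)" ?E by (rule diag_ad_linear)
  interpret F: Vector_Spaces.linear "(*\<^sub>C)" "(*\<^sub>C)" ?F by (rule diag_ad_linear)
  have linEF: "Vector_Spaces.linear (*\<^sub>C) (*\<^sub>C) (\<lambda>X. ?E (?F X))"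
    by unfold_locales (simp_all add: E.add F.add E.scale F.scale)
  have subE: "calg.subspace (?E ` ?V 0)"
    by (rule E.subspace_image[OF subspace_weight_space])
  have "?V 1 \<inter> {X. ?E (?F X) = 0} = {0}"
  proof (intro equalityI subsetI)
    fix X assume X: "X \<in> ?V 1 \<inter> {X. ?E (?F X) = 0}"
    obtain N where N: "(?E ^^ N) X = 0" using raise_nilpotent X by blast
    have "X = 0"
      by (rule raising_lowering_injective[OF diag_ad_linear diag_ad_linear diag_ad_linear
            diag_ad_relations(3) diag_ad_relations(1) _ _ N])
        (use X in \<open>auto simp: weight_space_iff cscale_one\<close>)
    thus "X \<in> {0}" by simp
  qed (auto simp: E.zero F.zero calg.subspace_0[OF subspace_weight_space])
  hence "calg.dim (?V 1) = calg.dim ((\<lambda>X. ?E (?F X)) ` ?V 1)"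
    using calg_rank_nullity[OF linEF subspace_weight_space finB VB, of 1]
      calg_dim_0 by simp
  also have "\<dots> \<le> calg.dim (?E ` ?V 0)"
  proof (rule calg_dim_mono[OF subE])
    show "calg.subspace ((\<lambda>X. ?E (?F X)) ` ?V 1)"
      by (rule module_hom.subspace_image[OF _ subspace_weight_space]) (rule linEF[unfolded Vector_Spaces.linear_iff_module_hom])
    show "(\<lambda>X. ?E (?F X)) ` ?V 1 \<subseteq> ?E ` ?V 0"
      using weight_space_lower[of _ k 1] by auto
    show "finite (?E ` B 0)" using finB by simp
    show "?E ` ?V 0 \<subseteq> calg.span (?E ` B 0)"
      using VB[of 0] E.span_image[of "B 0"] by auto
  qed
  finally have le: "calg.dim (?V 1) \<le> calg.dim (?E ` ?V 0)" .
  have "calg.dim (?E ` ?V 0) \<le> calg.dim (?V 1)"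
    using weight_space_raise[of _ k 0]
    by (intro calg_dim_mono[OF subspace_weight_space subE _ finB VB]) auto
  with le have "calg.dim (?E ` ?V 0) = calg.dim (?V 1)" by simp
  thus ?thesis
    using calg_rank_nullity[OF diag_ad_linear[of sl2_raise] subspace_weight_space finB VB[of 0]]
    by (simp add: centralizer_degree_le_eq dim_weight_space)
qed

lemma subspace_centralizer: "calg.subspace (centralizer_sl2 :: (U_sl2, 'n :: finite) tensor_power set)"
  by (rule calg.subspaceI)
    (auto simp: centralizer_sl2_def algebra_simps mult_cscale_left mult_cscale_right)

lemma degree_less_Suc: "degree_less (Suc k) = degree_le k"
  by (simp add: degree_less_def degree_le_def less_Suc_eq_le)

lemma dim_centralizer_degree_less:
  "calg.dim (centralizer_sl2 \<inter> degree_less k :: (U_sl2, 'n :: finite) tensor_power set) +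
     card {\<mu> :: 'n \<Rightarrow> _. pbw_degree \<mu> < k \<and> pbw_weight \<mu> = 1} =
   card {\<mu> :: 'n \<Rightarrow> _. pbw_degree \<mu> < k \<and> pbw_weight \<mu> = 0}"
proof (cases k)
  case 0
  \<comment> \<open>In degree less than 0 only the zero vector remains, and both counts are of empty
    sets.\<close>
  have "centralizer_sl2 \<inter> degree_less 0 = ({0} :: (U_sl2, 'n) tensor_power set)"
    using calg.subspace_0[OF subspace_centralizer] by (auto simp: degree_less_def)
  thus ?thesis using calg_dim_0 by (simp add: 0)
next
  case (Suc k')
  thus ?thesis by (simp only: degree_less_Suc less_Suc_eq_le dim_centralizer_degree_le)
qed

text \<open>Subtracting the formulas for degree below \<open>k\<close> and at most \<open>k\<close>
  leaves the counts in degree exactly \<open>k\<close>. The additive form avoids truncated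
  subtraction on the naturals.\<close>

lemma dim_centralizer_quotient:
  "vectorspace.dim class_ring (quotient_space
       (centralizer_sl2 \<inter> degree_le k :: (U_sl2, 'n :: finite) tensor_power set) (centralizer_sl2 \<inter> degree_less k)) +
     card {\<mu> :: 'n \<Rightarrow> _. pbw_degree \<mu> = k \<and> pbw_weight \<mu> = 1} =
   card {\<mu> :: 'n \<Rightarrow> _. pbw_degree \<mu> = k \<and> pbw_weight \<mu> = 0}"
proof -
  have split: "card {\<mu> :: 'n \<Rightarrow> _. pbw_degree \<mu> \<le> k \<and> pbw_weight \<mu> = w} =
      card {\<mu> :: 'n \<Rightarrow> _. pbw_degree \<mu> < k \<and> pbw_weight \<mu> = w} +
      card {\<mu> :: 'n \<Rightarrow> _. pbw_degree \<mu> = k \<and> pbw_weight \<mu> = w}" for w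
  proof -
    have "{\<mu> :: 'n \<Rightarrow> _. pbw_degree \<mu> \<le> k \<and> pbw_weight \<mu> = w} =
      {\<mu>. pbw_degree \<mu> < k \<and> pbw_weight \<mu> = w} \<union> {\<mu>. pbw_degree \<mu> = k \<and> pbw_weight \<mu> = w}"
      by auto
    moreover have "finite {\<mu> :: 'n \<Rightarrow> _. pbw_degree \<mu> < k \<and> pbw_weight \<mu> = w}"
      "finite {\<mu> :: 'n \<Rightarrow> _. pbw_degree \<mu> = k \<and> pbw_weight \<mu> = w}"
      by (rule finite_subset[OF _ finite_pbw_degree[of k]]; auto)+
    ultimately show ?thesis by (simp add: card_Un_disjoint disjoint_iff)
  qed
  have "vectorspace.dim class_ring (quotient_space
       (centralizer_sl2 \<inter> degree_le k :: (U_sl2, 'n) tensor_power set) (centralizer_sl2 \<inter> degree_less k)) +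
     calg.dim (centralizer_sl2 \<inter> degree_less k :: (U_sl2, 'n) tensor_power set) =
     calg.dim (centralizer_sl2 \<inter> degree_le k :: (U_sl2, 'n) tensor_power set)"
  proof (rule dim_quotient_space)
    show "calg.subspace (centralizer_sl2 \<inter> degree_le k :: (U_sl2, 'n) tensor_power set)"
      unfolding degree_le_def by (intro calg.subspace_inter subspace_centralizer calg.subspace_span)
    show "calg.subspace (centralizer_sl2 \<inter> degree_less k :: (U_sl2, 'n) tensor_power set)"
      unfolding degree_less_def by (intro calg.subspace_inter subspace_centralizer calg.subspace_span)
    show "centralizer_sl2 \<inter> degree_less k \<subseteq> (centralizer_sl2 \<inter> degree_le k :: (U_sl2, 'n) tensor_power set)"
      unfolding degree_less_def degree_le_def by (intro Int_mono subset_refl calg.span_mono) auto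
    show "finite (pbw ` {\<mu> :: 'n \<Rightarrow> _. pbw_degree \<mu> \<le> k})"
      by (intro finite_imageI finite_pbw_degree)
    show "(centralizer_sl2 \<inter> degree_le k :: (U_sl2, 'n) tensor_power set) \<subseteq>
        calg.span (pbw ` {\<mu>. pbw_degree \<mu> \<le> k})"
      by (simp add: degree_le_eq_span_pbw)
  qed
  thus ?thesis
    using dim_centralizer_degree_le[of k, where 'n = 'n] dim_centralizer_degree_less[of k, where 'n = 'n]
    unfolding split by linarith
qed

theorem proposition6p1:
  fixes n r :: nat
  assumes "CARD('n :: finite) = n" and "n \<ge> 2" and "r = n - 2"
  shows "hilbert_poincare_series TYPE('n) =
           fps_of_poly (P_poly r) / (1 - fps_X ^ 2) ^ (3 * (r + 1))"
proof -
  have card: "CARD('n) = Suc (Suc r)" using assms by simp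
  \<comment> \<open>With s = n - 1 = Suc r, these are the series
    \<open>binom_prod_fps (s - w) s w\<close> for the weights w = 0 and w = 1.\<close>
  let ?G0 = "binom_prod_fps (Suc r) (Suc r) 0" and ?G1 = "binom_prod_fps r (Suc r) 1"
  have "hilbert_poincare_series TYPE('n) =
      binom_fps (Suc r) * ((?G0 oo fps_X ^ 2) - fps_X * (?G1 oo fps_X ^ 2))"
  proof (rule fps_ext)
    fix k
    let ?N = "\<lambda>w. card {\<mu> :: 'n \<Rightarrow> _. pbw_degree \<mu> = k \<and> pbw_weight \<mu> = w}"
    \<comment> \<open>Replacing \<open>?N 0\<close> by the dimension plus \<open>?N 1\<close> turns
      the additive identity over the naturals into a difference of rationals.\<close>
    have "fps_nth (hilbert_poincare_series TYPE('n)) k = of_nat (?N 0) - of_nat (?N 1)"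
      unfolding dim_centralizer_quotient[of k, where 'n = 'n, symmetric]
      by (simp add: hilbert_poincare_series_def)
    also have "of_nat (?N 0) = fps_nth (binom_fps (Suc r) * (?G0 oo fps_X ^ 2)) k"
      using card_degree_weight_fps[OF card, of 0 k] by simp
    also have "of_nat (?N 1) = fps_nth (binom_fps (Suc r) * (fps_X * (?G1 oo fps_X ^ 2))) k"
      using card_degree_weight_fps[OF card, of 1 k] by simp
    finally show "fps_nth (hilbert_poincare_series TYPE('n)) k =
        fps_nth (binom_fps (Suc r) * ((?G0 oo fps_X ^ 2) - fps_X * (?G1 oo fps_X ^ 2))) k"
      by (simp only: right_diff_distrib fps_sub_nth)
  qed
  thus ?thesis by (simp only: hilbert_series_eq)
qed

end
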